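(* For every $\lambda$-term $M\in\Lambda$ we have $\mathcal{T}_n(\mathrm{BT}(M))=\mathrm{NF}(\mathcal{T}(M))$, where $\mathcal{T}_n(\mathrm{BT}(M))=\bigcup_{A\in\mathcal{A}(M)}\mathcal{T}_n(A)$.
   Context: Call-by-value $\lambda$-calculus with permutations: fix a denumerable set of variables; $\lambda$-terms and values are $M,N::=V\mid MN$ and $V::=x\mid \lambda x.M$ (application associates to the left), up to $\alpha$-conversion; $M\{x:=N\}$ is capture-avoiding substitution and $\mathrm{FV}(M)$ the set of free variables. Rules: $(\beta_v)$ $(\lambda x.M)V\to M\{x:=V\}$ if $V$ is a value; $(\sigma_1)$ $(\lambda x.M)NP\to(\lambda x.MP)N$ if $x\notin\mathrm{FV}(P)$; $(\sigma_3)$ $V((\lambda x.M)N)\to(\lambda x.VM)N$ if $V$ is a value and $x\notin\mathrm{FV}(V)$. $\to_{\mathsf v}$ is the contextual closure of the union of these rules, $\twoheadrightarrow_{\mathsf v}$ its reflexive-transitive closure. Approximants: $\Lambda_\bot$ is the set of $\lambda$-terms possibly containing a constant $\bot$ (in $\Lambda_\bot$, $\bot$ counts as a value). $\sqsubseteq$ is the smallest context-closed preorder on $\Lambda_\bot$ with $\bot\sqsubseteq x$ and $\bot\sqsubseteq\lambda x.M$ for all variables $x$ and $M\in\Lambda_\bot$. The set $\mathcal A$ of approximants is generated by ($k\ge0$): $A::=B\mid C$; $B::=x\mid\lambda x.A\mid\bot\mid xBA_1\cdots A_k$; $C::=(\lambda x.A)(yBA_1\cdots A_k)$. For $M\in\Lambda$,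 $\mathcal A(M)=\{A\in\mathcal A\mid \exists N\in\Lambda,\ M\twoheadrightarrow_{\mathsf v}N,\ A\sqsubseteq N\}$, and the Böhm tree $\mathrm{BT}(M)$ is the supremum $\bigsqcup\mathcal A(M)$. Resource calculus: resource values $u,v::=x\mid\lambda x.t$; simple terms $s,t::=st\mid[v_1,\dots,v_k]$ ($k\ge0$; a bag $[v_1,\dots,v_k]$ is a finite multiset); resource terms are resource values or simple terms. $[x^n]$ is the bag with $n$ copies of $x$. Linear substitution: if $x$ has exactly $n$ free occurrences in $e$, enumerated $x_1,\dots,x_n$, then $e\langle x:=v_1,\dots,v_n\rangle=\{e[x_1:=v_{\pi(1)},\dots,x_n:=v_{\pi(n)}]\mid \pi\text{ a permutation of }\{1,\dots,n\}\}$, and otherwise it is $\emptyset$. Constructors are extended to sets multilinearly: $\lambda x.\mathcal T=\{\lambda x.t\mid t\in\mathcal T\}$, $\mathcal S\mathcal T=\{st\mid s\in\mathcal S,t\in\mathcal T\}$, $[\mathcal V_1,\dots,\mathcal V_k]=\{[v_1,\dots,v_k]\mid v_i\in\mathcal V_i\}$. Rules: $(\beta_r)$ $[\lambda x.t][v_1,\dots,v_n]\to t\langle x:=v_1,\dots,v_n\rangle$; $(0)$ $[v_1,\dots,v_n]t\to\emptyset$ if $n\ne1$; $(\sigma_1)$ $[\lambda x.t]s_1s_2\to[\lambda x.ts_2]s_1$ if $x\notin\mathrm{FV}(s_1)$; $(\sigma_3)$ $[v]([\lambda x.t]s)\to[\lambda x.[v]t]s$ if $x\notin\mathrm{FV}(v)$.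 $\to_{\mathsf r}$ (between finite sets of resource terms) is the smallest relation containing these rules and closed under: $t\to\mathcal T$ implies $\lambda x.t\to\lambda x.\mathcal T$; $s\to\mathcal S$ implies $st\to\mathcal S t$; $t\to\mathcal T$ implies $st\to s\mathcal T$; $v_0\to\mathcal V_0$ implies $[v_0,v_1,\dots,v_k]\to[\mathcal V_0,v_1,\dots,v_k]$; $e\to\mathcal E_1$ and $e\notin\mathcal E_2$ imply $\{e\}\cup\mathcal E_2\to\mathcal E_1\cup\mathcal E_2$. $\to_{\mathsf r}$ is confluent and strongly normalizing; $\mathrm{nf}(e)$ is the (finite set) normal form of $e$ and $\mathrm{NF}(\mathcal E)=\bigcup_{e\in\mathcal E}\mathrm{nf}(e)$. Taylor expansion: $\mathcal T(x)=\{[x^n]\mid n\ge0\}$, $\mathcal T(\lambda x.N)=\{[\lambda x.t_1,\dots,\lambda x.t_n]\mid n\ge0,\ t_i\in\mathcal T(N)\}$, $\mathcal T(PQ)=\{st\mid s\in\mathcal T(P),t\in\mathcal T(Q)\}$. Normalized Taylor expansion of approximants: $\mathcal T_n(x)=\{[x^n]\mid n\ge0\}$; $\mathcal T_n(\lambda x.A')=\{[\lambda x.t_1,\dots,\lambda x.t_n]\mid n\ge0,\ t_i\in\mathcal T_n(A')\}$; $\mathcal T_n(\bot)=\{[\,]\}$; $\mathcal T_n(xBA_1\cdots A_k)=\{[x]t_0t_1\cdots t_k\mid t_0\in\mathcal T_n(B),\ t_i\in\mathcal T_n(A_i)\}$; $\mathcal T_n((\lambda x.A')(yBA_1\cdots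 A_k))=\{[\lambda x.s]t\mid s\in\mathcal T_n(A'),\ t\in\mathcal T_n(yBA_1\cdots A_k)\}$.
   Formalization: In the resource rule (σ1) the side condition is read as x ∉ FV(s2) (the moved term is not captured) instead of the printed x ∉ FV(s1), under which reduction would capture variables, fail to be confluent, and leave nf undefined. *)

theory Defs
  imports Main "HOL-Library.Multiset"
begin

datatype lterm = Var nat | Lam lterm | App lterm lterm

fun is_val :: "lterm \<Rightarrow> bool" where
  "is_val (Var _) = True"
| "is_val (Lam _) = True"
| "is_val (App _ _) = False"

primrec lift :: "nat \<Rightarrow> lterm \<Rightarrow> lterm" where
  "lift k (Var n) = Var (if n < k then n else Suc n)"
| "lift k (Lam M) = Lam (lift (Suc k) M)"
| "lift k (App M N) = App (lift k M) (lift k N)"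

primrec subst :: "lterm \<Rightarrow> nat \<Rightarrow> lterm \<Rightarrow> lterm" where
  "subst (Var n) k N = (if n < k then Var n else if n = k then N else Var (n - 1))"
| "subst (Lam M) k N = Lam (subst M (Suc k) (lift 0 N))"
| "subst (App M P) k N = App (subst M k N) (subst P k N)"

inductive vstep :: "lterm \<Rightarrow> lterm \<Rightarrow> bool" where
  beta_v: "is_val V \<Longrightarrow> vstep (App (Lam M) V) (subst M 0 V)"
| sigma1: "vstep (App (App (Lam M) N) P) (App (Lam (App M (lift 0 P))) N)"
| sigma3: "is_val V \<Longrightarrow> vstep (App V (App (Lam M) N)) (App (Lam (App (lift 0 V) M)) N)"
| ctx_lam: "vstep M M' \<Longrightarrow> vstep (Lam M) (Lam M')"
| ctx_appl: "vstep M M' \<Longrightarrow> vstep (App M N) (App M' N)"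
| ctx_appr: "vstep N N' \<Longrightarrow> vstep (App M N) (App M N')"

abbreviation vsteps :: "lterm \<Rightarrow> lterm \<Rightarrow> bool" where
  "vsteps \<equiv> vstep\<^sup>*\<^sup>*"

datatype bterm = BVar nat | BLam bterm | BApp bterm bterm | Bot

primrec emb :: "lterm \<Rightarrow> bterm" where
  "emb (Var n) = BVar n"
| "emb (Lam M) = BLam (emb M)"
| "emb (App M N) = BApp (emb M) (emb N)"

inductive bleq :: "bterm \<Rightarrow> bterm \<Rightarrow> bool" where
  bleq_refl: "bleq M M"
| bleq_trans: "bleq M N \<Longrightarrow> bleq N P \<Longrightarrow> bleq M P"
| bleq_bot_var: "bleq Bot (BVar x)"
| bleq_bot_lam: "bleq Bot (BLam M)"
| bleq_lam: "bleq M M' \<Longrightarrow> bleq (BLam M) (BLam M')"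
| bleq_appl: "bleq M M' \<Longrightarrow> bleq (BApp M N) (BApp M' N)"
| bleq_appr: "bleq N N' \<Longrightarrow> bleq (BApp M N) (BApp M N')"

definition bapps :: "bterm \<Rightarrow> bterm list \<Rightarrow> bterm" where
  "bapps h As = foldl BApp h As"

inductive isA and isB where
  B_var: "isB (BVar x)"
| B_lam: "isA A \<Longrightarrow> isB (BLam A)"
| B_bot: "isB Bot"
| B_app: "isB B \<Longrightarrow> (\<forall>a\<in>set As. isA a) \<Longrightarrow> isB (bapps (BApp (BVar x) B) As)"
| A_B: "isB B \<Longrightarrow> isA B"
| A_C: "isA A \<Longrightarrow> isB B \<Longrightarrow> (\<forall>a\<in>set As. isA a) \<Longrightarrow>
          isA (BApp (BLam A) (bapps (BApp (BVar y) B) As))"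

definition approxs :: "lterm \<Rightarrow> bterm set" where
  "approxs M = {A. isA A \<and> (\<exists>N. vsteps M N \<and> bleq A (emb N))}"

datatype rval = RV nat | RL rsimp
     and rsimp = RA rsimp rsimp | RB "rval multiset"

primrec rlift_v :: "nat \<Rightarrow> rval \<Rightarrow> rval" and rlift_s :: "nat \<Rightarrow> rsimp \<Rightarrow> rsimp" where
  "rlift_v k (RV n) = RV (if n < k then n else Suc n)"
| "rlift_v k (RL t) = RL (rlift_s (Suc k) t)"
| "rlift_s k (RA s t) = RA (rlift_s k s) (rlift_s k t)"
| "rlift_s k (RB b) = RB (image_mset (rlift_v k) b)"

text \<open>Linear substitution of the multiset of values vs for index k
  (values are lifted by k when placed, indices above k are decremented).
  lsubst_s k vs t t' holds iff t' is one of the terms in t<k := vs>;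
  the relation is empty when the number of occurrences differs from size vs.\<close>
inductive lsubst_v :: "nat \<Rightarrow> rval multiset \<Rightarrow> rval \<Rightarrow> rval \<Rightarrow> bool"
  and lsubst_s :: "nat \<Rightarrow> rval multiset \<Rightarrow> rsimp \<Rightarrow> rsimp \<Rightarrow> bool" where
  ls_hit: "lsubst_v k {#v#} (RV k) ((rlift_v 0 ^^ k) v)"
| ls_miss: "n \<noteq> k \<Longrightarrow> lsubst_v k {#} (RV n) (RV (if n < k then n else n - 1))"
| ls_lam: "lsubst_s (Suc k) vs t t' \<Longrightarrow> lsubst_v k vs (RL t) (RL t')"
| ls_app: "lsubst_s k vs1 s s' \<Longrightarrow> lsubst_s k vs2 t t' \<Longrightarrow>
             lsubst_s k (vs1 + vs2) (RA s t) (RA s' t')"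
| ls_nil: "lsubst_s k {#} (RB {#}) (RB {#})"
| ls_cons: "lsubst_v k vs1 u u' \<Longrightarrow> lsubst_s k vs2 (RB b) (RB b') \<Longrightarrow>
             lsubst_s k (vs1 + vs2) (RB (add_mset u b)) (RB (add_mset u' b'))"

definition lsubst :: "rsimp \<Rightarrow> rval multiset \<Rightarrow> rsimp set" where
  "lsubst t vs = {t'. lsubst_s 0 vs t t'}"

inductive rstep_v :: "rval \<Rightarrow> rval set \<Rightarrow> bool"
  and rstep_s :: "rsimp \<Rightarrow> rsimp set \<Rightarrow> bool" where
  r_beta: "rstep_s (RA (RB {#RL t#}) (RB vs)) (lsubst t vs)"
| r_zero: "size b \<noteq> 1 \<Longrightarrow> rstep_s (RA (RB b) t) {}"
| r_sigma1: "rstep_s (RA (RA (RB {#RL t#}) s1) s2) {RA (RB {#RL (RA t (rlift_s 0 s2))#}) s1}"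
| r_sigma3: "rstep_s (RA (RB {#v#}) (RA (RB {#RL t#}) s))
               {RA (RB {#RL (RA (RB {#rlift_v 0 v#}) t)#}) s}"
| r_lam: "rstep_s t T \<Longrightarrow> rstep_v (RL t) (RL ` T)"
| r_appl: "rstep_s s S \<Longrightarrow> rstep_s (RA s t) ((\<lambda>s'. RA s' t) ` S)"
| r_appr: "rstep_s t T \<Longrightarrow> rstep_s (RA s t) ((\<lambda>t'. RA s t') ` T)"
| r_bag: "rstep_v v V \<Longrightarrow> rstep_s (RB (add_mset v b)) ((\<lambda>v'. RB (add_mset v' b)) ` V)"

inductive rstep_set :: "rsimp set \<Rightarrow> rsimp set \<Rightarrow> bool" where
  "rstep_s e E1 \<Longrightarrow> e \<notin> E2 \<Longrightarrow> rstep_set (insert e E2) (E1 \<union> E2)"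

definition r_normal :: "rsimp set \<Rightarrow> bool" where
  "r_normal E \<longleftrightarrow> (\<nexists>E'. rstep_set E E')"

definition nf :: "rsimp \<Rightarrow> rsimp set" where
  "nf e = (THE E. rstep_set\<^sup>*\<^sup>* {e} E \<and> r_normal E)"

definition NF :: "rsimp set \<Rightarrow> rsimp set" where
  "NF S = (\<Union>e\<in>S. nf e)"

primrec taylor :: "lterm \<Rightarrow> rsimp set" where
  "taylor (Var x) = {RB (replicate_mset n (RV x)) | n. True}"
| "taylor (Lam N) = {RB (mset (map RL ts)) | ts. \<forall>t\<in>set ts. t \<in> taylor N}"
| "taylor (App P Q) = {RA s t | s t. s \<in> taylor P \<and> t \<in> taylor Q}"

text \<open>Normalized Taylor expansion of approximants. Tn_head handles the head
  position of an application, where the paper uses a singleton bag [x] resp.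
  [\<lambda>x.s]. On non-approximants the values are irrelevant.\<close>
fun Tn :: "bterm \<Rightarrow> rsimp set" and Tn_head :: "bterm \<Rightarrow> rsimp set" where
  "Tn (BVar x) = {RB (replicate_mset n (RV x)) | n. True}"
| "Tn (BLam A) = {RB (mset (map RL ts)) | ts. \<forall>t\<in>set ts. t \<in> Tn A}"
| "Tn Bot = {RB {#}}"
| "Tn (BApp P Q) = {RA s t | s t. s \<in> Tn_head P \<and> t \<in> Tn Q}"
| "Tn_head (BVar x) = {RB {#RV x#}}"
| "Tn_head (BLam A) = {RB {#RL s#} | s. s \<in> Tn A}"
| "Tn_head Bot = {}"
| "Tn_head (BApp P Q) = {RA s t | s t. s \<in> Tn_head P \<and> t \<in> Tn Q}"

end

theory Submission
  imports Defs
begin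

text \<open>
  Write \<open>t \<Rightarrow> t'\<close> if \<open>t'\<close> is an element of some one-step reduct of \<open>t\<close>. Resource reduction is
  locally confluent and terminates (it is linear, so beta decreases the size, while the sigma rules
  decrease a polynomial weight), hence \<open>nf t\<close> is the set of normal \<open>n\<close> with \<open>t \<Rightarrow>\<^sup>* n\<close>.
  A step \<open>M \<rightarrow> N\<close> makes every element of the expansion of \<open>M\<close> reduce to a set of elements of
  the expansion of \<open>N\<close>; conversely, every element of the expansion of \<open>N\<close> that does not reduce to the
  empty set is reached from the expansion of \<open>M\<close>; and a redex in an element of the expansion of \<open>M\<close>
  that does not vanish comes from a redex of \<open>M\<close>. So \<open>NF (taylor M)\<close> consists of the
  normal elements of the expansions of the reducts \<open>N\<close> of \<open>M\<close>, and these are the elements of the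
  normalized expansions of the approximants below such \<open>N\<close>.
\<close>

section \<open>Lifting and linear substitution\<close>

text \<open>The obstacle is that the two calculi do not move in step. A step of \<open>M\<close>
  under an abstraction affects every copy of the body in a bag, whereas a resource step contracts
  one copy; the terms in between need not belong to the expansion of any single term. After one copy
  has moved, the others have to be made to follow, and the normal form being pursued must survive
  this detour. Hence unique normal forms are used in the shape: every step out of \<open>t\<close>
  keeps every normal term that \<open>t\<close> reaches reachable
  (\<open>normal_form_preserved\<close>). A second obstacle is that \<open>rstep_set\<close> works
  on sets, where equal results of different elements merge. The argument therefore stays with single
  terms and uses two notions: \<open>reduces_into\<close>, a finite tree of steps all of whose
  leaves are controlled, and \<open>rred\<close>, one branch of such a tree. Commutation facts
  accordingly come in pairs: one covers all results, the other reaches a given result.\<close>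

lemma rterm_induct [case_names RV RL RA RB_empty RB_add]:
  assumes "\<And>n. P (RV n)"
    and "\<And>t. Q t \<Longrightarrow> P (RL t)"
    and "\<And>s t. Q s \<Longrightarrow> Q t \<Longrightarrow> Q (RA s t)"
    and "Q (RB {#})"
    and "\<And>u b. P u \<Longrightarrow> Q (RB b) \<Longrightarrow> Q (RB (add_mset u b))"
  shows "P v" and "Q t"
proof (induction v and t)
  case (RB b)
  then show ?case by (induction b) (auto intro: assms)
qed (auto intro: assms)

lemma rlift_rlift:
  "i \<le> k \<Longrightarrow> rlift_v (Suc k) (rlift_v i u) = rlift_v i (rlift_v k u)"
  "i \<le> k \<Longrightarrow> rlift_s (Suc k) (rlift_s i t) = rlift_s i (rlift_s k t)"
  by (induction u and t arbitrary: i k and i k rule: rterm_induct) auto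

lemma rlift_rlift_pow: "rlift_v (k + j) ((rlift_v 0 ^^ k) v) = (rlift_v 0 ^^ k) (rlift_v j v)"
  by (induction k arbitrary: j) (auto simp: rlift_rlift)

lemma rlift_le_rlift_pow: "i \<le> k \<Longrightarrow> rlift_v i ((rlift_v 0 ^^ k) v) = (rlift_v 0 ^^ Suc k) v"
proof (induction k arbitrary: i)
  case (Suc k)
  show ?case
  proof (cases i)
    case (Suc j)
    then show ?thesis using Suc.IH[of j] Suc.prems by (simp add: rlift_rlift)
  qed simp
qed simp

section \<open>Inversion rules for linear substitution\<close>

lemma lsubst_v_RV_iff [simp]:
  "lsubst_v k vs (RV n) r \<longleftrightarrow>
    (if n = k then \<exists>v. vs = {#v#} \<and> r = (rlift_v 0 ^^ k) v
     else vs = {#} \<and> r = RV (if n < k then n else n - 1))"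
proof
  show "lsubst_v k vs (RV n) r \<Longrightarrow> if n = k then \<exists>v. vs = {#v#} \<and> r = (rlift_v 0 ^^ k) v
     else vs = {#} \<and> r = RV (if n < k then n else n - 1)"
    by (erule lsubst_v.cases) auto
qed (auto split: if_splits intro: ls_hit ls_miss[of n k, simplified] simp: ls_miss[of n k, simplified])

lemma lsubst_v_RL_iff [simp]:
  "lsubst_v k vs (RL t) r \<longleftrightarrow> (\<exists>t'. r = RL t' \<and> lsubst_s (Suc k) vs t t')"
  by (auto intro: ls_lam) (erule lsubst_v.cases; blast)

lemma lsubst_s_RA_iff [simp]:
  "lsubst_s k vs (RA s t) r \<longleftrightarrow>
    (\<exists>vs1 vs2 s' t'. vs = vs1 + vs2 \<and> r = RA s' t' \<and> lsubst_s k vs1 s s' \<and> lsubst_s k vs2 t t')"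
  by (auto intro: lsubst_v_lsubst_s.intros) (erule lsubst_s.cases; blast)

lemma lsubst_s_RB_empty_iff [simp]: "lsubst_s k vs (RB {#}) r \<longleftrightarrow> vs = {#} \<and> r = RB {#}"
  by (auto intro: ls_nil elim: lsubst_s.cases)

text \<open>The rule \<open>ls_cons\<close> may peel off any element of the bag first. If a
  derivation starts with some other \<open>w\<close>, the induction hypothesis for the smaller bag
  extracts \<open>u\<close> from the rest, and \<open>w\<close> is put back with
  \<open>ls_cons\<close>.\<close>

lemma lsubst_s_RB_add_iff [simp]:
  "lsubst_s k vs (RB (add_mset u b)) r \<longleftrightarrow>
    (\<exists>vs1 vs2 u' b'. vs = vs1 + vs2 \<and> r = RB (add_mset u' b') \<and>
       lsubst_v k vs1 u u' \<and> lsubst_s k vs2 (RB b) (RB b'))"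
    (is "_ \<longleftrightarrow> ?R vs b r")
proof
  show "lsubst_s k vs (RB (add_mset u b)) r \<Longrightarrow> ?R vs b r"
  proof (induction "size b" arbitrary: b vs r rule: less_induct)
    case less
    from less.prems show ?case
    proof cases
      case (ls_cons vs1 w w' vs2 b0 b0')
      from ls_cons(2)
      consider "u = w" "b = b0" | c where "b = add_mset w c" "b0 = add_mset u c"
        by (auto simp: add_eq_conv_ex)
      then show ?thesis
      proof cases
        case 1
        then show ?thesis using ls_cons by blast
      next
        case 2
        with less.hyps[of c vs2 "RB b0'"] ls_cons
        obtain ws1 ws2 u' c' where *: "vs2 = ws1 + ws2" "b0' = add_mset u' c'"
          "lsubst_v k ws1 u u'" "lsubst_s k ws2 (RB c) (RB c')" by auto
        have "lsubst_s k (vs1 + ws2) (RB b) (RB (add_mset w' c'))"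
          unfolding 2 using ls_cons * by (intro lsubst_v_lsubst_s.ls_cons)
        then show ?thesis using ls_cons *
          by (metis (no_types, lifting) add_mset_commute union_lcomm)
      qed
    qed auto
  qed
qed (auto intro: lsubst_v_lsubst_s.intros)

lemma lsubst_s_RB_RB: "lsubst_s k vs (RB b) r \<Longrightarrow> \<exists>b'. r = RB b' \<and> size b' = size b"
  by (induction b arbitrary: vs r) force+

lemma lsubst_s_RB_single_iff [simp]:
  "lsubst_s k vs (RB {#u#}) r \<longleftrightarrow> (\<exists>u'. r = RB {#u'#} \<and> lsubst_v k vs u u')"
  by simp (metis empty_neutral(2))

lemma lsubst_s_to_RB_single_iff:
  "lsubst_s k vs (RB b) (RB {#u'#}) \<longleftrightarrow> (\<exists>u. b = {#u#} \<and> lsubst_v k vs u u')"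
proof
  assume "lsubst_s k vs (RB b) (RB {#u'#})"
  moreover from this obtain u where "b = {#u#}"
    by (metis lsubst_s_RB_RB rsimp.inject(2) size_1_singleton_mset size_single)
  ultimately show "\<exists>u. b = {#u#} \<and> lsubst_v k vs u u'" by (auto simp del: lsubst_s_RB_add_iff)
qed (auto simp del: lsubst_s_RB_add_iff)

lemma lsubst_s_to_RB_empty_iff [simp]: "lsubst_s k vs (RB b) (RB {#}) \<longleftrightarrow> vs = {#} \<and> b = {#}"
  using lsubst_s_RB_RB[of k vs b "RB {#}"] by auto

lemma lsubst_s_RB_union_iff:
  "lsubst_s k vs (RB (b + c)) r \<longleftrightarrow>
    (\<exists>vs1 vs2 b' c'. vs = vs1 + vs2 \<and> r = RB (b' + c') \<and>
       lsubst_s k vs1 (RB b) (RB b') \<and> lsubst_s k vs2 (RB c) (RB c'))"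
proof (induction b arbitrary: vs r)
  case empty
  then show ?case by simp (metis empty_neutral(1) lsubst_s_RB_RB)
next
  case (add u b)
  show ?case (is "?L = ?R")
  proof
    assume ?L
    then obtain vs1 vs2 x1 x2 u' b' c' where *: "vs = vs1 + (x1 + x2)" "r = RB (add_mset u' (b' + c'))"
      "lsubst_v k vs1 u u'" "lsubst_s k x1 (RB b) (RB b')" "lsubst_s k x2 (RB c) (RB c')"
      by (auto simp: add)
    then have "lsubst_s k (vs1 + x1) (RB (add_mset u b)) (RB (add_mset u' b'))"
      by (intro ls_cons)
    then show ?R using * by (metis add.assoc union_mset_add_mset_left)
  next
    assume ?R
    then obtain vs1 vs2 x1 x2 u' b' c' where *: "vs = vs1 + x1 + x2" "r = RB (add_mset u' (b' + c'))"
      "lsubst_v k vs1 u u'" "lsubst_s k x1 (RB b) (RB b')" "lsubst_s k x2 (RB c) (RB c')"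
      by auto
    then have "lsubst_s k (x1 + x2) (RB (b + c)) (RB (b' + c'))" using add by blast
    then show ?L using * by (metis add.assoc ls_cons union_mset_add_mset_left)
  qed
qed

text \<open>Inversion from the side of the result: each chosen element of the result bag can be
  traced to a source element and its share of \<open>vs\<close>. The substitution lemma needs this
  when an already substituted bag is split.\<close>

lemma lsubst_s_RB_to_add:
  assumes "lsubst_s k vs (RB b) (RB (add_mset u' c'))"
  shows "\<exists>vs1 vs2 u c. vs = vs1 + vs2 \<and> b = add_mset u c \<and>
    lsubst_v k vs1 u u' \<and> lsubst_s k vs2 (RB c) (RB c')"
  using assms
proof (induction b arbitrary: vs c')
  case (add w b)
  then obtain vs1 vs2 w' b' where *: "vs = vs1 + vs2" "add_mset u' c' = add_mset w' b'"
    "lsubst_v k vs1 w w'" "lsubst_s k vs2 (RB b) (RB b')" by auto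
  then consider "u' = w'" "c' = b'" | d where "c' = add_mset w' d" "b' = add_mset u' d"
    by (auto simp: add_eq_conv_ex)
  then show ?case
  proof cases
    case 1
    then show ?thesis using * by blast
  next
    case 2
    with * add.IH obtain x1 x2 u c where **: "vs2 = x1 + x2" "b = add_mset u c"
      "lsubst_v k x1 u u'" "lsubst_s k x2 (RB c) (RB d)" by blast
    have "lsubst_s k (vs1 + x2) (RB (add_mset w c)) (RB c')"
      unfolding 2 using * ** by (intro ls_cons)
    then show ?thesis using * ** by (metis (no_types, lifting) add_mset_commute union_lcomm)
  qed
qed auto

lemma lsubst_s_RB_to_union:
  assumes "lsubst_s k vs (RB b) (RB (b' + c'))"
  shows "\<exists>vs1 vs2 b1 c1. vs = vs1 + vs2 \<and> b = b1 + c1 \<and>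
    lsubst_s k vs1 (RB b1) (RB b') \<and> lsubst_s k vs2 (RB c1) (RB c')"
  using assms
proof (induction b' arbitrary: vs b)
  case empty
  then show ?case by (metis empty_neutral(1) ls_nil)
next
  case (add u' b')
  then obtain vs1 vs2 u c where *: "vs = vs1 + vs2" "b = add_mset u c"
    "lsubst_v k vs1 u u'" "lsubst_s k vs2 (RB c) (RB (b' + c'))"
    using lsubst_s_RB_to_add[of k vs b u' "b' + c'"] by auto
  with add.IH obtain x1 x2 b1 c1 where **: "vs2 = x1 + x2" "c = b1 + c1"
    "lsubst_s k x1 (RB b1) (RB b')" "lsubst_s k x2 (RB c1) (RB c')" by blast
  have "lsubst_s k (vs1 + x1) (RB (add_mset u b1)) (RB (add_mset u' b'))"
    using * ** by (intro ls_cons)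
  then show ?case using * ** by (metis add.assoc union_mset_add_mset_left)
qed

section \<open>Linear substitution against lifting and against itself\<close>

lemma lsubst_rlift_same:
  "lsubst_v k vs (rlift_v k u) r \<longleftrightarrow> vs = {#} \<and> r = u"
  "lsubst_s k vs (rlift_s k t) r' \<longleftrightarrow> vs = {#} \<and> r' = t"
proof (induction u and t arbitrary: k vs r and k vs r' rule: rterm_induct)
  case (RV n)
  show ?case by simp
next
  case (RL t)
  show ?case by (simp add: RL) blast
next
  case (RA s t)
  show ?case by (auto simp: RA)
next
  case RB_empty
  show ?case by simp
next
  case (RB_add u b)
  from RB_add(2) have "lsubst_s k ws (RB (image_mset (rlift_v k) b)) (RB b') \<longleftrightarrow> ws = {#} \<and> b' = b"
    for ws b' by (metis rlift_s.simps(2) rsimp.inject(2))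
  then show ?case by (auto simp: RB_add(1))
qed

text \<open>The same \<open>vs\<close> stands on both sides because values are lifted only when
  placed, by the number of binders crossed; the extra binder in \<open>Suc k\<close> accounts for
  the extra lift of the placed values.\<close>

lemma lsubst_rlift_le:
  "i \<le> k \<Longrightarrow> lsubst_v (Suc k) vs (rlift_v i u) r \<longleftrightarrow> (\<exists>u'. r = rlift_v i u' \<and> lsubst_v k vs u u')"
  "i \<le> k \<Longrightarrow> lsubst_s (Suc k) vs (rlift_s i t) r' \<longleftrightarrow> (\<exists>t'. r' = rlift_s i t' \<and> lsubst_s k vs t t')"
proof (induction u and t arbitrary: i k vs r and i k vs r' rule: rterm_induct)
  case (RV n)
  then show ?case by (auto simp: rlift_le_rlift_pow simp del: funpow.simps)
next
  case (RL t)
  show ?case using RL(1)[of "Suc i" "Suc k" vs] RL(2) by simp (metis rlift_v.simps(2))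
next
  case (RA s t)
  then show ?case by auto (metis rlift_s.simps(1))+
next
  case (RB_add u b)
  have "lsubst_s (Suc k) ws (RB (image_mset (rlift_v i) b)) (RB b') \<longleftrightarrow>
    (\<exists>b''. b' = image_mset (rlift_v i) b'' \<and> lsubst_s k ws (RB b) (RB b''))" for ws b'
    using RB_add(2)[OF RB_add(3), of ws "RB b'"] by (auto dest: lsubst_s_RB_RB)
       (metis lsubst_s_RB_RB rlift_s.simps(2) rsimp.inject(2))
  note b = this
  show ?case (is "?L = ?R")
  proof
    assume ?L
    then obtain vs1 vs2 u' b' where "vs = vs1 + vs2" "r' = RB (add_mset (rlift_v i u') (image_mset (rlift_v i) b'))"
      "lsubst_v k vs1 u u'" "lsubst_s k vs2 (RB b) (RB b')" using b RB_add(1,3) by auto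
    then show ?R by (intro exI[of _ "RB (add_mset u' b')"]) (auto intro: ls_cons simp del: lsubst_s_RB_add_iff)
  next
    assume ?R
    then obtain vs1 vs2 u' b' where "vs = vs1 + vs2" "r' = RB (add_mset (rlift_v i u') (image_mset (rlift_v i) b'))"
      "lsubst_v k vs1 u u'" "lsubst_s k vs2 (RB b) (RB b')" by auto
    then show ?L using b RB_add(1,3) by (auto intro!: ls_cons simp del: lsubst_s_RB_add_iff)
  qed
qed auto

lemma lsubst_rlift_pow:
  "lsubst_v (j + k) vs ((rlift_v 0 ^^ j) w) r \<longleftrightarrow> (\<exists>w'. r = (rlift_v 0 ^^ j) w' \<and> lsubst_v k vs w w')"
  by (induction j arbitrary: r) (auto simp: lsubst_rlift_le)

text \<open>The cutoff is \<open>j\<close> in the scope of the values, \<open>k + j\<close> after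
  crossing \<open>k\<close> binders, and one more as long as the index \<open>k\<close> has not been
  removed.\<close>

lemma lsubst_rlift_ge:
  "lsubst_v k (image_mset (rlift_v j) vs) (rlift_v (Suc (k + j)) u) r \<longleftrightarrow>
    (\<exists>u'. r = rlift_v (k + j) u' \<and> lsubst_v k vs u u')"
  "lsubst_s k (image_mset (rlift_v j) vs) (rlift_s (Suc (k + j)) t) r' \<longleftrightarrow>
    (\<exists>t'. r' = rlift_s (k + j) t' \<and> lsubst_s k vs t t')"
proof (induction u and t arbitrary: k vs r and k vs r' rule: rterm_induct)
  case (RV n)
  have "image_mset (rlift_v j) vs = {#v#} \<longleftrightarrow> (\<exists>w. vs = {#w#} \<and> v = rlift_v j w)" for v
    by (auto dest: msed_map_invR)
  then show ?case by (cases "n = k") (auto simp: rlift_rlift_pow[symmetric])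
next
  case (RL t)
  show ?case using RL[of "Suc k" vs] by simp (metis rlift_v.simps(2))
next
  case (RA s t)
  show ?case (is "?L = ?R")
  proof
    assume ?L
    then obtain vs1 vs2 s' t' where "image_mset (rlift_v j) vs = vs1 + vs2" and *: "r' = RA s' t'"
      "lsubst_s k vs1 (rlift_s (Suc (k + j)) s) s'" "lsubst_s k vs2 (rlift_s (Suc (k + j)) t) t'" by auto
    moreover from this(1) obtain ws1 ws2 where "vs = ws1 + ws2" "vs1 = image_mset (rlift_v j) ws1"
      "vs2 = image_mset (rlift_v j) ws2" using image_mset_eq_plusD by metis
    ultimately obtain s'' t'' where "r' = rlift_s (k + j) (RA s'' t'')" "vs = ws1 + ws2"
      "lsubst_s k ws1 s s''" "lsubst_s k ws2 t t''" using RA by auto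
    then show ?R by (blast intro: ls_app)
  next
    assume ?R
    then obtain ws1 ws2 s'' t'' where "r' = RA (rlift_s (k + j) s'') (rlift_s (k + j) t'')" "vs = ws1 + ws2"
      "lsubst_s k ws1 s s''" "lsubst_s k ws2 t t''" by auto
    then show ?L using RA by (auto intro!: ls_app simp del: lsubst_s_RA_iff)
  qed
next
  case (RB_add u b)
  have *: "lsubst_s k (image_mset (rlift_v j) ws) (RB (image_mset (rlift_v (Suc (k + j))) b)) (RB b') \<longleftrightarrow>
    (\<exists>b''. b' = image_mset (rlift_v (k + j)) b'' \<and> lsubst_s k ws (RB b) (RB b''))" for ws b'
    using RB_add(2)[of k ws "RB b'"] by (auto dest: lsubst_s_RB_RB)
       (metis lsubst_s_RB_RB rlift_s.simps(2) rsimp.inject(2))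
  show ?case (is "?L = ?R")
  proof
    assume ?L
    then obtain vs1 vs2 u' b' where "image_mset (rlift_v j) vs = vs1 + vs2" "r' = RB (add_mset u' b')"
      "lsubst_v k vs1 (rlift_v (Suc (k + j)) u) u'"
      "lsubst_s k vs2 (RB (image_mset (rlift_v (Suc (k + j))) b)) (RB b')" by auto
    moreover from this(1) obtain ws1 ws2 where "vs = ws1 + ws2" "vs1 = image_mset (rlift_v j) ws1"
      "vs2 = image_mset (rlift_v j) ws2" using image_mset_eq_plusD by metis
    ultimately obtain u'' b'' where "r' = rlift_s (k + j) (RB (add_mset u'' b''))" "vs = ws1 + ws2"
      "lsubst_v k ws1 u u''" "lsubst_s k ws2 (RB b) (RB b'')" using RB_add(1) * by auto
    then show ?R by (blast intro: ls_cons)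
  next
    assume ?R
    then obtain ws1 ws2 u'' b'' where "vs = ws1 + ws2"
      "r' = RB (add_mset (rlift_v (k + j) u'') (image_mset (rlift_v (k + j)) b''))"
      "lsubst_v k ws1 u u''" "lsubst_s k ws2 (RB b) (RB b'')" by auto
    then show ?L using RB_add(1) * by (auto intro!: ls_cons simp del: lsubst_s_RB_add_iff)
  qed
qed auto

text \<open>The substitution lemma in linear form: \<open>vs\<close> splits into the values that go
  into the term and those that go into the bag \<open>ws\<close>, which is treated as a resource
  term of its own. Each direction serves one half of the commutation of beta steps with
  substitution.\<close>

lemma lsubst_lsubst:
  "(\<exists>u'. lsubst_v j ws u u' \<and> lsubst_v (j + k) vs u' r) \<longleftrightarrow>
   (\<exists>vs1 vs2 u1 ws'. vs = vs1 + vs2 \<and> lsubst_v (Suc (j + k)) vs1 u u1 \<and>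
      lsubst_s k vs2 (RB ws) (RB ws') \<and> lsubst_v j ws' u1 r)"
  "(\<exists>t'. lsubst_s j ws t t' \<and> lsubst_s (j + k) vs t' r') \<longleftrightarrow>
   (\<exists>vs1 vs2 t1 ws'. vs = vs1 + vs2 \<and> lsubst_s (Suc (j + k)) vs1 t t1 \<and>
      lsubst_s k vs2 (RB ws) (RB ws') \<and> lsubst_s j ws' t1 r')"
proof (induction u and t arbitrary: j ws vs r and j ws vs r' rule: rterm_induct)
  case (RV n)
  consider "n = j" | "n < j" | "n = Suc (j + k)" | "n > j" "n \<noteq> Suc (j + k)" by linarith
  then show ?case
  proof cases
    case 1
    have "(\<exists>v. ws = {#v#} \<and> (\<exists>w'. r = (rlift_v 0 ^^ j) w' \<and> lsubst_v k vs v w')) \<longleftrightarrow>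
      (\<exists>v. lsubst_s k vs (RB ws) (RB {#v#}) \<and> r = (rlift_v 0 ^^ j) v)"
      by (auto simp: lsubst_s_to_RB_single_iff)
    with 1 show ?thesis by (auto simp: lsubst_rlift_pow)
  next
    case 3
    \<comment> \<open>The value placed for the outer variable has crossed the inner binder, so index
      \<open>j\<close> does not occur in it and only the empty bag can be substituted for
      \<open>j\<close>.\<close>
    have *: "(rlift_v 0 ^^ Suc (j + k)) v = rlift_v j ((rlift_v 0 ^^ (j + k)) v)" for v
      by (simp add: rlift_le_rlift_pow del: funpow.simps)
    show ?thesis (is "?L = ?R")
    proof
      assume ?L
      with 3 show ?R
        by (intro exI[of _ vs] exI[of _ "{#}"]) (auto simp: * lsubst_rlift_same simp del: funpow.simps)
    next
      assume ?R
      with 3 show ?L by (auto simp: * lsubst_rlift_same simp del: funpow.simps)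
    qed
  qed auto
next
  case (RL t)
  show ?case (is "?L = ?R")
  proof
    assume ?L
    then obtain t' r0 where "r = RL r0" "lsubst_s (Suc j) ws t t'" "lsubst_s (Suc j + k) vs t' r0" by auto
    moreover from calculation RL[of "Suc j" ws vs r0] obtain vs1 vs2 t1 ws' where
      "vs = vs1 + vs2" "lsubst_s (Suc (Suc j + k)) vs1 t t1" "lsubst_s k vs2 (RB ws) (RB ws')"
      "lsubst_s (Suc j) ws' t1 r0" by blast
    ultimately show ?R
      by (intro exI[of _ vs1] exI[of _ vs2] exI[of _ "RL t1"] exI[of _ ws']) auto
  next
    assume ?R
    then obtain vs1 vs2 t1 ws' r0 where "r = RL r0"
      "vs = vs1 + vs2" "lsubst_s (Suc (Suc j + k)) vs1 t t1" "lsubst_s k vs2 (RB ws) (RB ws')"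
      "lsubst_s (Suc j) ws' t1 r0" by auto
    moreover from calculation RL[of "Suc j" ws vs r0] obtain t' where
      "lsubst_s (Suc j) ws t t'" "lsubst_s (Suc j + k) vs t' r0" by blast
    ultimately show ?L by (intro exI[of _ "RL t'"]) auto
  qed
next
  case (RA s t)
  show ?case (is "?L = ?R")
  proof
    assume ?L
    then obtain ws1 ws2 vs1 vs2 s' t' s'' t'' where "ws = ws1 + ws2" "vs = vs1 + vs2" "r' = RA s'' t''"
      "lsubst_s j ws1 s s'" "lsubst_s j ws2 t t'"
      "lsubst_s (j + k) vs1 s' s''" "lsubst_s (j + k) vs2 t' t''" by auto
    moreover from calculation RA(1)[of j ws1 vs1 s''] obtain x1 x2 s1 ws1' where
      "vs1 = x1 + x2" "lsubst_s (Suc (j + k)) x1 s s1" "lsubst_s k x2 (RB ws1) (RB ws1')"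
      "lsubst_s j ws1' s1 s''" by blast
    moreover from calculation RA(2)[of j ws2 vs2 t''] obtain y1 y2 t1 ws2' where
      "vs2 = y1 + y2" "lsubst_s (Suc (j + k)) y1 t t1" "lsubst_s k y2 (RB ws2) (RB ws2')"
      "lsubst_s j ws2' t1 t''" by blast
    moreover have "(x1 + x2) + (y1 + y2) = (x1 + y1) + (x2 + y2)" by simp
    moreover have "lsubst_s k (x2 + y2) (RB ws) (RB (ws1' + ws2'))"
      using calculation lsubst_s_RB_union_iff by blast
    moreover have "lsubst_s (Suc (j + k)) (x1 + y1) (RA s t) (RA s1 t1)"
      using calculation by (intro ls_app)
    moreover have "lsubst_s j (ws1' + ws2') (RA s1 t1) r'"
      unfolding \<open>r' = _\<close> using calculation by (intro ls_app)
    ultimately show ?R by metis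
  next
    assume ?R
    then obtain vs1 vs2 s1 t1 ws' x1 x2 where "vs = (x1 + x2) + vs2"
      "lsubst_s (Suc (j + k)) x1 s s1" "lsubst_s (Suc (j + k)) x2 t t1"
      "lsubst_s k vs2 (RB ws) (RB ws')" "lsubst_s j ws' (RA s1 t1) r'" by auto
    moreover from calculation obtain w1 w2 s'' t'' where "ws' = w1 + w2" "r' = RA s'' t''"
      "lsubst_s j w1 s1 s''" "lsubst_s j w2 t1 t''" by auto
    moreover from calculation obtain vs2a vs2b ws1 ws2 where "vs2 = vs2a + vs2b" "ws = ws1 + ws2"
      "lsubst_s k vs2a (RB ws1) (RB w1)" "lsubst_s k vs2b (RB ws2) (RB w2)"
      using lsubst_s_RB_to_union by blast
    moreover from calculation RA(1)[of j ws1 "x1 + vs2a" s''] obtain s' where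
      "lsubst_s j ws1 s s'" "lsubst_s (j + k) (x1 + vs2a) s' s''" by blast
    moreover from calculation RA(2)[of j ws2 "x2 + vs2b" t''] obtain t' where
      "lsubst_s j ws2 t t'" "lsubst_s (j + k) (x2 + vs2b) t' t''" by blast
    moreover have "(x1 + x2) + (vs2a + vs2b) = (x1 + vs2a) + (x2 + vs2b)" by simp
    moreover have "lsubst_s j ws (RA s t) (RA s' t')"
      unfolding \<open>ws = _\<close> using calculation by (intro ls_app)
    moreover have "lsubst_s (j + k) ((x1 + vs2a) + (x2 + vs2b)) (RA s' t') r'"
      unfolding \<open>r' = _\<close> using calculation by (intro ls_app)
    ultimately show ?L by metis
  qed
next
  case RB_empty
  then show ?case by auto
next
  case (RB_add u b)
  show ?case (is "?L = ?R")
  proof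
    assume ?L
    then obtain ws1 ws2 vs1 vs2 u' b' u'' b'' where "ws = ws1 + ws2" "vs = vs1 + vs2"
      "r' = RB (add_mset u'' b'')" "lsubst_v j ws1 u u'" "lsubst_s j ws2 (RB b) (RB b')"
      "lsubst_v (j + k) vs1 u' u''" "lsubst_s (j + k) vs2 (RB b') (RB b'')" by auto
    moreover from calculation RB_add(1)[of j ws1 vs1 u''] obtain x1 x2 u1 ws1' where
      "vs1 = x1 + x2" "lsubst_v (Suc (j + k)) x1 u u1" "lsubst_s k x2 (RB ws1) (RB ws1')"
      "lsubst_v j ws1' u1 u''" by blast
    moreover from calculation RB_add(2)[of j ws2 vs2 "RB b''"] obtain y1 y2 t1 ws2' where
      "vs2 = y1 + y2" "lsubst_s (Suc (j + k)) y1 (RB b) t1" "lsubst_s k y2 (RB ws2) (RB ws2')"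
      "lsubst_s j ws2' t1 (RB b'')" by blast
    moreover from calculation obtain b1 where "t1 = RB b1" using lsubst_s_RB_RB by blast
    moreover have "(x1 + x2) + (y1 + y2) = (x1 + y1) + (x2 + y2)" by simp
    moreover have "lsubst_s k (x2 + y2) (RB ws) (RB (ws1' + ws2'))"
      using calculation lsubst_s_RB_union_iff by blast
    moreover have "lsubst_s (Suc (j + k)) (x1 + y1) (RB (add_mset u b)) (RB (add_mset u1 b1))"
      using calculation by (intro ls_cons) simp_all
    moreover have "lsubst_s j (ws1' + ws2') (RB (add_mset u1 b1)) r'"
      unfolding \<open>r' = _\<close> using calculation by (intro ls_cons) simp_all
    ultimately show ?R by metis
  next
    assume ?R
    then obtain vs1 vs2 u1 b1 ws' x1 x2 where "vs = (x1 + x2) + vs2"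
      "lsubst_v (Suc (j + k)) x1 u u1" "lsubst_s (Suc (j + k)) x2 (RB b) (RB b1)"
      "lsubst_s k vs2 (RB ws) (RB ws')" "lsubst_s j ws' (RB (add_mset u1 b1)) r'" by auto
    moreover from calculation obtain w1 w2 u'' b'' where "ws' = w1 + w2" "r' = RB (add_mset u'' b'')"
      "lsubst_v j w1 u1 u''" "lsubst_s j w2 (RB b1) (RB b'')" by auto
    moreover from calculation obtain vs2a vs2b ws1 ws2 where "vs2 = vs2a + vs2b" "ws = ws1 + ws2"
      "lsubst_s k vs2a (RB ws1) (RB w1)" "lsubst_s k vs2b (RB ws2) (RB w2)"
      using lsubst_s_RB_to_union by blast
    moreover from calculation RB_add(1)[of j ws1 "x1 + vs2a" u''] obtain u' where
      "lsubst_v j ws1 u u'" "lsubst_v (j + k) (x1 + vs2a) u' u''" by blast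
    moreover from calculation RB_add(2)[of j ws2 "x2 + vs2b" "RB b''"] obtain t' where
      "lsubst_s j ws2 (RB b) t'" "lsubst_s (j + k) (x2 + vs2b) t' (RB b'')" by blast
    moreover from calculation obtain b' where "t' = RB b'" using lsubst_s_RB_RB by blast
    moreover have "(x1 + x2) + (vs2a + vs2b) = (x1 + vs2a) + (x2 + vs2b)" by simp
    moreover have "lsubst_s j ws (RB (add_mset u b)) (RB (add_mset u' b'))"
      unfolding \<open>ws = _\<close> using calculation by (intro ls_cons) simp_all
    moreover have "lsubst_s (j + k) ((x1 + vs2a) + (x2 + vs2b)) (RB (add_mset u' b')) r'"
      unfolding \<open>r' = _\<close> using calculation by (intro ls_cons) simp_all
    ultimately show ?L by metis
  qed
qed

section \<open>Reduction under substitution\<close>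

lemma r_bag_RL: "rstep_s t T \<Longrightarrow> rstep_s (RB (add_mset (RL t) b)) ((\<lambda>t'. RB (add_mset (RL t') b)) ` T)"
  using r_bag[OF r_lam, of t T b] by (simp add: image_image)

lemma rstep_v_iff: "rstep_v v V \<longleftrightarrow> (\<exists>t T. v = RL t \<and> V = RL ` T \<and> rstep_s t T)"
  by (auto intro: r_lam) (erule rstep_v.cases; blast)

text \<open>A value steps only if it is an abstraction, so the mutual induction collapses to one on
  simple terms with a single rule for bags.\<close>

lemma rstep_s_induct [consumes 1, case_names beta zero sigma1 sigma3 appl appr bag]:
  assumes "rstep_s t T"
    and "\<And>t vs. P (RA (RB {#RL t#}) (RB vs)) (lsubst t vs)"
    and "\<And>b t. size b \<noteq> 1 \<Longrightarrow> P (RA (RB b) t) {}"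
    and "\<And>t s1 s2. P (RA (RA (RB {#RL t#}) s1) s2) {RA (RB {#RL (RA t (rlift_s 0 s2))#}) s1}"
    and "\<And>v t s. P (RA (RB {#v#}) (RA (RB {#RL t#}) s)) {RA (RB {#RL (RA (RB {#rlift_v 0 v#}) t)#}) s}"
    and "\<And>s S t. rstep_s s S \<Longrightarrow> P s S \<Longrightarrow> P (RA s t) ((\<lambda>s'. RA s' t) ` S)"
    and "\<And>t T s. rstep_s t T \<Longrightarrow> P t T \<Longrightarrow> P (RA s t) ((\<lambda>t'. RA s t') ` T)"
    and "\<And>t T b. rstep_s t T \<Longrightarrow> P t T \<Longrightarrow>
      P (RB (add_mset (RL t) b)) ((\<lambda>t'. RB (add_mset (RL t') b)) ` T)"
  shows "P t T"
  using assms(1)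
proof (induction rule: rstep_v_rstep_s.inducts(2)
    [where ?P1.0 = "\<lambda>v V. \<exists>t T. v = RL t \<and> V = RL ` T \<and> rstep_s t T \<and> P t T"])
  case (r_bag v V b)
  then show ?case using assms(8) by (auto simp: image_image)
qed (use assms in blast)+

lemma rstep_s_RB_cases:
  assumes "rstep_s (RB b) E"
  obtains t b0 T where "b = add_mset (RL t) b0" "rstep_s t T" "E = (\<lambda>t'. RB (add_mset (RL t') b0)) ` T"
  using assms by cases (auto simp: rstep_v_iff image_image)

lemma rstep_s_rlift: "rstep_s t T \<Longrightarrow> rstep_s (rlift_s k t) (rlift_s k ` T)"
proof (induction arbitrary: k rule: rstep_s_induct)
  case (beta t vs)
  have "rlift_s k ` lsubst t vs = lsubst (rlift_s (Suc k) t) (image_mset (rlift_v k) vs)"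
    using lsubst_rlift_ge(2)[of 0 k vs t] by (auto simp: lsubst_def)
  then show ?case by (simp add: r_beta)
next
  case (zero b t)
  then show ?case by (simp add: r_zero)
next
  case (sigma1 t s1 s2)
  then show ?case using r_sigma1[of "rlift_s (Suc k) t" "rlift_s k s1" "rlift_s k s2"]
    by (simp add: rlift_rlift)
next
  case (sigma3 v t s)
  then show ?case using r_sigma3[of "rlift_v k v" "rlift_s (Suc k) t" "rlift_s k s"]
    by (simp add: rlift_rlift)
next
  case (appl s S t)
  then show ?case using r_appl[OF appl.IH, of k "rlift_s k t"] by (simp add: image_image)
next
  case (appr t T s)
  then show ?case using r_appr[OF appr.IH, of "rlift_s k s" k] by (simp add: image_image)
next
  case (bag t T b)
  then show ?case using r_bag_RL[OF bag.IH, of "Suc k" "image_mset (rlift_v k) b"]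
    by (simp add: image_image)
qed

lemma rstep_v_rlift_pow: "rstep_v v V \<Longrightarrow> rstep_v ((rlift_v 0 ^^ k) v) ((rlift_v 0 ^^ k) ` V)"
proof (induction k)
  case (Suc k)
  then obtain t T where "(rlift_v 0 ^^ k) v = RL t" "(rlift_v 0 ^^ k) ` V = RL ` T" "rstep_s t T"
    by (auto simp: rstep_v_iff)
  moreover from this(2) have "(rlift_v 0 ^^ Suc k) ` V = RL ` rlift_s (Suc 0) ` T"
    by (simp only: funpow.simps image_comp[symmetric]) (simp add: image_image)
  ultimately show ?case using rstep_s_rlift[of t T "Suc 0"] by (auto simp: rstep_v_iff)
qed simp

definition rred :: "rsimp \<Rightarrow> rsimp \<Rightarrow> bool" where
  "rred t t' \<longleftrightarrow> (\<exists>T. rstep_s t T \<and> t' \<in> T)"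

lemma rredI: "rstep_s t T \<Longrightarrow> t' \<in> T \<Longrightarrow> rred t t'"
  by (auto simp: rred_def)

text \<open>Redexes survive linear substitution: it preserves the sizes of bags and sends
  abstractions to abstractions. The results of the surviving step are instances of results of the
  original one.\<close>

lemma rstep_s_lsubst:
  assumes "rstep_s t T" "lsubst_s k vs t t'"
  shows "\<exists>T'. rstep_s t' T' \<and> (\<forall>f\<in>T'. \<exists>t2\<in>T. lsubst_s k vs t2 f)"
  using assms
proof (induction arbitrary: k vs t' rule: rstep_s_induct)
  case (beta t ws)
  then obtain vs1 vs2 u ws' where *: "vs = vs1 + vs2" "t' = RA (RB {#RL u#}) (RB ws')"
    "lsubst_s (Suc k) vs1 t u" "lsubst_s k vs2 (RB ws) (RB ws')"
    by (auto simp del: lsubst_s_RB_add_iff) (metis lsubst_s_RB_RB)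
  have "\<exists>t2\<in>lsubst t ws. lsubst_s k vs t2 f" if "f \<in> lsubst u ws'" for f
    using lsubst_lsubst(2)[of 0 ws t k vs f] * that by (auto simp: lsubst_def)
  then show ?case using * r_beta by blast
next
  case (zero b t)
  then obtain b' r where "t' = RA (RB b') r" "size b' \<noteq> 1"
    using lsubst_s_RB_RB by (auto, metis)
  then show ?case using r_zero by blast
next
  case (sigma1 t s1 s2)
  then obtain vs1 vs2 vs3 u r1 r2 where *: "vs = vs1 + vs2 + vs3" "t' = RA (RA (RB {#RL u#}) r1) r2"
    "lsubst_s (Suc k) vs1 t u" "lsubst_s k vs2 s1 r1" "lsubst_s k vs3 s2 r2"
    by (auto simp del: lsubst_s_RB_add_iff)
  then have "lsubst_s (Suc k) (vs1 + vs3) (RA t (rlift_s 0 s2)) (RA u (rlift_s 0 r2))"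
    by (intro ls_app) (auto simp: lsubst_rlift_le)
  then have "lsubst_s k (vs1 + vs3 + vs2) (RA (RB {#RL (RA t (rlift_s 0 s2))#}) s1)
    (RA (RB {#RL (RA u (rlift_s 0 r2))#}) r1)"
    using * by (intro ls_app) (auto simp del: lsubst_s_RB_add_iff)
  moreover have "vs1 + vs3 + vs2 = vs" using * by simp
  ultimately show ?case unfolding *(2) using r_sigma1[of u r1 r2] by (metis singletonD singletonI)
next
  case (sigma3 v t s)
  then obtain vs1 vs2 vs3 w u r where *: "vs = vs1 + (vs2 + vs3)" "t' = RA (RB {#w#}) (RA (RB {#RL u#}) r)"
    "lsubst_v k vs1 v w" "lsubst_s (Suc k) vs2 t u" "lsubst_s k vs3 s r"
    by (auto simp del: lsubst_s_RB_add_iff)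
  then have "lsubst_s (Suc k) (vs1 + vs2) (RA (RB {#rlift_v 0 v#}) t) (RA (RB {#rlift_v 0 w#}) u)"
    by (intro ls_app) (auto simp: lsubst_rlift_le simp del: lsubst_s_RB_add_iff)
  then have "lsubst_s k (vs1 + vs2 + vs3) (RA (RB {#RL (RA (RB {#rlift_v 0 v#}) t)#}) s)
    (RA (RB {#RL (RA (RB {#rlift_v 0 w#}) u)#}) r)"
    using * by (intro ls_app) (auto simp del: lsubst_s_RB_add_iff)
  moreover have "vs1 + vs2 + vs3 = vs" using * by simp
  ultimately show ?case unfolding *(2) using r_sigma3[of w u r] by (metis singletonD singletonI)
next
  case (appl s S t)
  then obtain vs1 vs2 r u where *: "vs = vs1 + vs2" "t' = RA r u" "lsubst_s k vs1 s r" "lsubst_s k vs2 t u"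
    by auto
  then obtain S' where S': "rstep_s r S'" "\<forall>f\<in>S'. \<exists>t2\<in>S. lsubst_s k vs1 t2 f" using appl.IH by blast
  then have "\<exists>t2\<in>(\<lambda>s. RA s t) ` S. lsubst_s k vs t2 f" if "f \<in> (\<lambda>s. RA s u) ` S'" for f
    using that * by (auto intro: ls_app simp del: lsubst_s_RA_iff)
  then show ?case using * r_appl[OF S'(1), of u] by blast
next
  case (appr t T s)
  then obtain vs1 vs2 r u where *: "vs = vs1 + vs2" "t' = RA r u" "lsubst_s k vs1 s r" "lsubst_s k vs2 t u"
    by auto
  then obtain T' where T': "rstep_s u T'" "\<forall>f\<in>T'. \<exists>t2\<in>T. lsubst_s k vs2 t2 f" using appr.IH by blast
  then have "\<exists>t2\<in>(\<lambda>t. RA s t) ` T. lsubst_s k vs t2 f" if "f \<in> (\<lambda>t. RA r t) ` T'" for f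
    using that * by (auto intro: ls_app simp del: lsubst_s_RA_iff)
  then show ?case using * r_appr[OF T'(1), of r] by blast
next
  case (bag t T b)
  then obtain vs1 vs2 u c where *: "vs = vs1 + vs2" "t' = RB (add_mset (RL u) c)"
    "lsubst_s (Suc k) vs1 t u" "lsubst_s k vs2 (RB b) (RB c)"
    by auto
  then obtain T' where T': "rstep_s u T'" "\<forall>f\<in>T'. \<exists>t2\<in>T. lsubst_s (Suc k) vs1 t2 f" using bag.IH by blast
  then have "\<exists>t2\<in>(\<lambda>t. RB (add_mset (RL t) b)) ` T. lsubst_s k vs t2 f"
    if "f \<in> (\<lambda>t. RB (add_mset (RL t) c)) ` T'" for f
    using that * by (auto simp del: lsubst_s_RB_add_iff) (blast intro: ls_cons ls_lam)
  then show ?case using * r_bag_RL[OF T'(1), of c] by blast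
qed

text \<open>The companion of \<open>rstep_s_lsubst\<close>: an instance of a reduct is itself
  reached from a suitable instance of the redex. Together they settle the overlap of a beta step
  with a step in the body.\<close>

lemma rstep_s_lsubst_back:
  assumes "rstep_s t T" "t1 \<in> T" "lsubst_s k vs t1 f"
  shows "\<exists>t'. lsubst_s k vs t t' \<and> rred t' f"
  using assms
proof (induction arbitrary: k vs t1 f rule: rstep_s_induct)
  case (beta t ws)
  then obtain vs1 vs2 u ws' where *: "vs = vs1 + vs2" "lsubst_s (Suc k) vs1 t u"
    "lsubst_s k vs2 (RB ws) (RB ws')" "lsubst_s 0 ws' u f"
    using lsubst_lsubst(2)[of 0 ws t k vs f] by (auto simp: lsubst_def)
  then have "lsubst_s k vs (RA (RB {#RL t#}) (RB ws)) (RA (RB {#RL u#}) (RB ws'))"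
    by (auto intro!: ls_app simp del: lsubst_s_RA_iff lsubst_s_RB_add_iff)
  then show ?case using *(4) by (metis lsubst_def mem_Collect_eq r_beta rredI)
next
  case (zero b t)
  then show ?case by simp
next
  case (sigma1 t s1 s2)
  then obtain vs1 vs2 vs3 u r1 r2 where *: "vs = vs1 + vs3 + vs2"
    "f = RA (RB {#RL (RA u (rlift_s 0 r2))#}) r1"
    "lsubst_s (Suc k) vs1 t u" "lsubst_s k vs2 s1 r1" "lsubst_s k vs3 s2 r2"
    by (auto simp: lsubst_rlift_le simp del: lsubst_s_RB_add_iff)
  then have "lsubst_s k (vs1 + vs2 + vs3) (RA (RA (RB {#RL t#}) s1) s2) (RA (RA (RB {#RL u#}) r1) r2)"
    by (intro ls_app) (auto simp del: lsubst_s_RB_add_iff)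
  moreover have "vs1 + vs2 + vs3 = vs" using * by simp
  ultimately show ?case using * r_sigma1 by (metis insertI1 rredI)
next
  case (sigma3 v t s)
  then obtain vs1 vs2 vs3 w u r where *: "vs = vs1 + vs2 + vs3"
    "f = RA (RB {#RL (RA (RB {#rlift_v 0 w#}) u)#}) r"
    "lsubst_v k vs1 v w" "lsubst_s (Suc k) vs2 t u" "lsubst_s k vs3 s r"
    by (auto simp: lsubst_rlift_le simp del: lsubst_s_RB_add_iff)
  then have "lsubst_s k (vs1 + (vs2 + vs3)) (RA (RB {#v#}) (RA (RB {#RL t#}) s)) (RA (RB {#w#}) (RA (RB {#RL u#}) r))"
    by (intro ls_app) (auto simp del: lsubst_s_RB_add_iff)
  moreover have "vs1 + (vs2 + vs3) = vs" using * by simp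
  ultimately show ?case using * r_sigma3 by (metis insertI1 rredI)
next
  case (appl s S t)
  then obtain vs1 vs2 s1 r u where *: "vs = vs1 + vs2" "f = RA r u" "s1 \<in> S"
    "lsubst_s k vs1 s1 r" "lsubst_s k vs2 t u" by auto
  then obtain s' S' where "lsubst_s k vs1 s s'" "rstep_s s' S'" "r \<in> S'"
    using appl.IH unfolding rred_def by blast
  then show ?case using * by (intro exI[of _ "RA s' u"]) (auto intro: ls_app rredI[OF r_appl] simp del: lsubst_s_RA_iff)
next
  case (appr t T s)
  then obtain vs1 vs2 s1 r u where *: "vs = vs1 + vs2" "f = RA r u" "s1 \<in> T"
    "lsubst_s k vs1 s r" "lsubst_s k vs2 s1 u" by auto
  then obtain s' S' where "lsubst_s k vs2 t s'" "rstep_s s' S'" "u \<in> S'"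
    using appr.IH unfolding rred_def by blast
  then show ?case using * by (intro exI[of _ "RA r s'"]) (auto intro: ls_app rredI[OF r_appr] simp del: lsubst_s_RA_iff)
next
  case (bag t T b)
  then obtain vs1 vs2 s1 u c where *: "vs = vs1 + vs2" "f = RB (add_mset (RL u) c)" "s1 \<in> T"
    "lsubst_s (Suc k) vs1 s1 u" "lsubst_s k vs2 (RB b) (RB c)" by auto
  then obtain s' S' where "lsubst_s (Suc k) vs1 t s'" "rstep_s s' S'" "u \<in> S'"
    using bag.IH unfolding rred_def by blast
  then show ?case using * by (intro exI[of _ "RB (add_mset (RL s') c)"])
     (auto intro!: ls_cons ls_lam rredI[OF r_bag_RL] simp del: lsubst_s_RB_add_iff)
qed

text \<open>By linearity the occurrence of \<open>v\<close> in \<open>ws\<close> is placed exactly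
  once, so its step becomes one step of the result. With its converse below, this settles the
  overlap of a beta step with a step in the argument bag.\<close>

lemma lsubst_rstep_v:
  "lsubst_v k ws u u' \<Longrightarrow> v \<in># ws \<Longrightarrow> rstep_v v V \<Longrightarrow>
    \<exists>U. rstep_v u' U \<and> (\<forall>f\<in>U. \<exists>v'\<in>V. lsubst_v k (add_mset v' (ws - {#v#})) u f)"
  "lsubst_s k ws t t' \<Longrightarrow> v \<in># ws \<Longrightarrow> rstep_v v V \<Longrightarrow>
    \<exists>T. rstep_s t' T \<and> (\<forall>f\<in>T. \<exists>v'\<in>V. lsubst_s k (add_mset v' (ws - {#v#})) t f)"
proof (induction rule: lsubst_v_lsubst_s.inducts)
  case (ls_hit k w)
  then show ?case using rstep_v_rlift_pow[of v V k] by auto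
next
  case (ls_lam k vs t t')
  then obtain T where "rstep_s t' T" "\<forall>f\<in>T. \<exists>v'\<in>V. lsubst_s (Suc k) (add_mset v' (vs - {#v#})) t f"
    by blast
  then show ?case by (intro exI[of _ "RL ` T"]) (auto intro: r_lam)
next
  case (ls_app k vs1 s s' vs2 t t')
  consider "v \<in># vs1" | "v \<in># vs2" using ls_app.prems by auto
  then show ?case
  proof cases
    case 1
    with ls_app obtain T where T: "rstep_s s' T"
      "\<forall>f\<in>T. \<exists>v'\<in>V. lsubst_s k (add_mset v' (vs1 - {#v#})) s f" by blast
    have "add_mset v' (vs1 + vs2 - {#v#}) = add_mset v' (vs1 - {#v#}) + vs2" for v' using 1 by simp
    then have "\<exists>v'\<in>V. lsubst_s k (add_mset v' (vs1 + vs2 - {#v#})) (RA s t) (RA x t')" if "x \<in> T" for x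
      using that T(2) ls_app.hyps(2) lsubst_v_lsubst_s.ls_app by metis
    then show ?thesis using r_appl[OF T(1), of t'] by blast
  next
    case 2
    with ls_app obtain T where T: "rstep_s t' T"
      "\<forall>f\<in>T. \<exists>v'\<in>V. lsubst_s k (add_mset v' (vs2 - {#v#})) t f" by blast
    have "add_mset v' (vs1 + vs2 - {#v#}) = vs1 + add_mset v' (vs2 - {#v#})" for v' using 2 by simp
    then have "\<exists>v'\<in>V. lsubst_s k (add_mset v' (vs1 + vs2 - {#v#})) (RA s t) (RA s' x)" if "x \<in> T" for x
      using that T(2) ls_app.hyps(1) lsubst_v_lsubst_s.ls_app by metis
    then show ?thesis using r_appr[OF T(1), of s'] by blast
  qed
next
  case (ls_cons k vs1 u u' vs2 b b')
  consider "v \<in># vs1" | "v \<in># vs2" using ls_cons.prems by auto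
  then show ?case
  proof cases
    case 1
    with ls_cons obtain T where T: "rstep_v u' T"
      "\<forall>f\<in>T. \<exists>v'\<in>V. lsubst_v k (add_mset v' (vs1 - {#v#})) u f" by blast
    have "add_mset v' (vs1 + vs2 - {#v#}) = add_mset v' (vs1 - {#v#}) + vs2" for v' using 1 by simp
    then have "\<exists>v'\<in>V. lsubst_s k (add_mset v' (vs1 + vs2 - {#v#})) (RB (add_mset u b)) (RB (add_mset x b'))"
      if "x \<in> T" for x using that T(2) ls_cons.hyps(2) lsubst_v_lsubst_s.ls_cons by metis
    then show ?thesis using r_bag[OF T(1), of b'] by blast
  next
    case 2
    with ls_cons obtain T where T: "rstep_s (RB b') T"
      "\<forall>f\<in>T. \<exists>v'\<in>V. lsubst_s k (add_mset v' (vs2 - {#v#})) (RB b) f" by blast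
    then obtain r c S where S: "b' = add_mset (RL r) c" "rstep_s r S" "T = (\<lambda>t'. RB (add_mset (RL t') c)) ` S"
      using rstep_s_RB_cases by metis
    \<comment> \<open>A step of a bag contracts one of its elements, so it remains a step after
      \<open>u'\<close> has joined the bag.\<close>
    let ?S = "(\<lambda>t'. RB (add_mset (RL t') (add_mset u' c))) ` S"
    have "add_mset v' (vs1 + vs2 - {#v#}) = vs1 + add_mset v' (vs2 - {#v#})" for v' using 2 by simp
    then have "\<exists>v'\<in>V. lsubst_s k (add_mset v' (vs1 + vs2 - {#v#})) (RB (add_mset u b))
      (RB (add_mset u' (add_mset (RL x) c)))" if "x \<in> S" for x
      using that T(2) ls_cons.hyps(1) lsubst_v_lsubst_s.ls_cons unfolding S(3) by (metis imageI)
    then have "\<exists>v'\<in>V. lsubst_s k (add_mset v' (vs1 + vs2 - {#v#})) (RB (add_mset u b)) f" if "f \<in> ?S" for f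
      using that by (auto simp: add_mset_commute simp del: lsubst_s_RB_add_iff)
    moreover have "rstep_s (RB (add_mset u' b')) ?S" using r_bag_RL[OF S(2), of "add_mset u' c"] S(1)
      by (simp add: add_mset_commute)
    ultimately show ?thesis by blast
  qed
qed simp_all

lemma lsubst_rstep_v_back:
  "lsubst_v k ws u f \<Longrightarrow> v' \<in># ws \<Longrightarrow> v' \<in> V \<Longrightarrow> rstep_v v V \<Longrightarrow>
    \<exists>u' U. lsubst_v k (add_mset v (ws - {#v'#})) u u' \<and> rstep_v u' U \<and> f \<in> U"
  "lsubst_s k ws t f' \<Longrightarrow> v' \<in># ws \<Longrightarrow> v' \<in> V \<Longrightarrow> rstep_v v V \<Longrightarrow>
    \<exists>t' T. lsubst_s k (add_mset v (ws - {#v'#})) t t' \<and> rstep_s t' T \<and> f' \<in> T"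
proof (induction rule: lsubst_v_lsubst_s.inducts)
  case (ls_hit k w)
  then show ?case using rstep_v_rlift_pow[of v V k] by auto
next
  case (ls_lam k vs t t')
  then obtain r T where "lsubst_s (Suc k) (add_mset v (vs - {#v'#})) t r" "rstep_s r T" "t' \<in> T" by blast
  then show ?case by (intro exI[of _ "RL r"] exI[of _ "RL ` T"]) (auto intro: r_lam)
next
  case (ls_app k vs1 s s' vs2 t t')
  consider "v' \<in># vs1" | "v' \<in># vs2" using ls_app.prems by auto
  then show ?case
  proof cases
    case 1
    with ls_app obtain r T where T: "lsubst_s k (add_mset v (vs1 - {#v'#})) s r" "rstep_s r T" "s' \<in> T" by blast
    have "add_mset v (vs1 + vs2 - {#v'#}) = add_mset v (vs1 - {#v'#}) + vs2" using 1 by simp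
    then show ?thesis using r_appl[OF T(2), of t'] T ls_app.hyps(2)
      by (metis imageI lsubst_v_lsubst_s.ls_app)
  next
    case 2
    with ls_app obtain r T where T: "lsubst_s k (add_mset v (vs2 - {#v'#})) t r" "rstep_s r T" "t' \<in> T" by blast
    have "add_mset v (vs1 + vs2 - {#v'#}) = vs1 + add_mset v (vs2 - {#v'#})" using 2 by simp
    then show ?thesis using r_appr[OF T(2), of s'] T ls_app.hyps(1)
      by (metis imageI lsubst_v_lsubst_s.ls_app)
  qed
next
  case (ls_cons k vs1 u u' vs2 b b')
  consider "v' \<in># vs1" | "v' \<in># vs2" using ls_cons.prems by auto
  then show ?case
  proof cases
    case 1
    with ls_cons obtain r T where T: "lsubst_v k (add_mset v (vs1 - {#v'#})) u r" "rstep_v r T" "u' \<in> T" by blast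
    have "add_mset v (vs1 + vs2 - {#v'#}) = add_mset v (vs1 - {#v'#}) + vs2" using 1 by simp
    then show ?thesis using r_bag[OF T(2), of b'] T ls_cons.hyps(2)
      by (metis imageI lsubst_v_lsubst_s.ls_cons)
  next
    case 2
    with ls_cons obtain r T where T: "lsubst_s k (add_mset v (vs2 - {#v'#})) (RB b) r" "rstep_s r T" "RB b' \<in> T" by blast
    from T(1) obtain d where d: "r = RB d" using lsubst_s_RB_RB by blast
    from T(2)[unfolded d] T(3) obtain p c S p' where
      S: "d = add_mset (RL p) c" "rstep_s p S" "b' = add_mset (RL p') c" "p' \<in> S"
      by (auto elim!: rstep_s_RB_cases)
    have "add_mset v (vs1 + vs2 - {#v'#}) = vs1 + add_mset v (vs2 - {#v'#})" using 2 by simp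
    moreover have "lsubst_s k (vs1 + add_mset v (vs2 - {#v'#})) (RB (add_mset u b)) (RB (add_mset u' d))"
      using T ls_cons.hyps(1) d by (intro lsubst_v_lsubst_s.ls_cons) auto
    moreover have "rstep_s (RB (add_mset u' d)) ((\<lambda>t'. RB (add_mset (RL t') (add_mset u' c))) ` S)"
      using r_bag_RL[OF S(2), of "add_mset u' c"] S(1) by (simp add: add_mset_commute)
    moreover have "RB (add_mset u' b') = RB (add_mset (RL p') (add_mset u' c))"
      using S by (simp add: add_mset_commute)
    ultimately show ?thesis using S(4) by (metis imageI)
  qed
qed simp_all

section \<open>Local confluence\<close>

text \<open>A well-founded tree of steps from a single term, with all leaves in \<open>P\<close>. A
  branch may also end in a step to the empty set, for which the condition on the successors is
  vacuous. Distinct branches never merge, unlike in \<open>rstep_set\<close>.\<close>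

inductive reduces_into :: "(rsimp \<Rightarrow> bool) \<Rightarrow> rsimp \<Rightarrow> bool" for P where
  into_base: "P t \<Longrightarrow> reduces_into P t"
| into_step: "rstep_s t T \<Longrightarrow> \<forall>t'\<in>T. reduces_into P t' \<Longrightarrow> reduces_into P t"

text \<open>Contexts are taken semantically, as maps that commute with steps. This admits lifting as
  a context and lets the right-hand sides of the sigma rules be read as contexts of the subterms
  they move.\<close>

definition rctx :: "(rsimp \<Rightarrow> rsimp) \<Rightarrow> bool" where
  "rctx C \<longleftrightarrow> (\<forall>t T. rstep_s t T \<longrightarrow> rstep_s (C t) (C ` T))"

lemma rctx_id: "rctx (\<lambda>x. x)" by (simp add: rctx_def)
lemma rctx_appl: "rctx C \<Longrightarrow> rctx (\<lambda>x. RA (C x) t)"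
  unfolding rctx_def using r_appl by (fastforce simp: image_image)
lemma rctx_appr: "rctx C \<Longrightarrow> rctx (\<lambda>x. RA s (C x))"
  unfolding rctx_def using r_appr by (fastforce simp: image_image)
lemma rctx_bag: "rctx C \<Longrightarrow> rctx (\<lambda>x. RB (add_mset (RL (C x)) b))"
  unfolding rctx_def using r_bag_RL by (fastforce simp: image_image)
lemma rctx_rlift: "rctx C \<Longrightarrow> rctx (\<lambda>x. rlift_s k (C x))"
  unfolding rctx_def using rstep_s_rlift by (fastforce simp: image_image)

lemmas rctx_intros = rctx_id rctx_appl rctx_appr rctx_bag rctx_rlift

lemma rctx_rred: "rctx C \<Longrightarrow> rred s t \<Longrightarrow> rred (C s) (C t)"
  unfolding rctx_def rred_def by blast

lemma rctx_rreds:
  assumes "rctx C" "rred\<^sup>*\<^sup>* s t"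
  shows "rred\<^sup>*\<^sup>* (C s) (C t)"
  using assms(2)
  by (induction rule: rtranclp_induct)
    (auto intro: rctx_rred[OF assms(1)] rtranclp.rtrancl_into_rtrancl)

lemma reduces_into_mono: "reduces_into P t \<Longrightarrow> (\<And>x. P x \<Longrightarrow> Q x) \<Longrightarrow> reduces_into Q t"
  by (induction rule: reduces_into.induct) (auto intro: reduces_into.intros)

lemma reduces_into_bind:
  "reduces_into P t \<Longrightarrow> (\<And>x. P x \<Longrightarrow> reduces_into Q x) \<Longrightarrow> reduces_into Q t"
  by (induction rule: reduces_into.induct) (auto intro: reduces_into.intros)

lemma reduces_into_ctx:
  assumes "reduces_into P t" "rctx C" "\<And>x. P x \<Longrightarrow> Q (C x)"
  shows "reduces_into Q (C t)"
  using assms(1)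
proof (induction rule: reduces_into.induct)
  case (into_base t)
  then show ?case using assms(3) reduces_into.into_base by blast
next
  case (into_step t T)
  then have "rstep_s (C t) (C ` T)" using assms(2) by (auto simp: rctx_def)
  then show ?case using into_step by (auto intro: reduces_into.into_step)
qed

text \<open>A weak form of joinability that suffices for unique normal forms: all reducts of \<open>E1\<close> have to be
  accounted for, whereas in \<open>E2\<close> single paths are followed.\<close>

definition joins :: "rsimp set \<Rightarrow> rsimp set \<Rightarrow> bool" where
  "joins E1 E2 \<longleftrightarrow> (\<forall>e1\<in>E1. reduces_into (\<lambda>f. \<exists>e2\<in>E2. rred\<^sup>*\<^sup>* e2 f) e1)"

definition cojoins :: "rsimp set \<Rightarrow> rsimp set \<Rightarrow> bool" where
  "cojoins E1 E2 \<longleftrightarrow> joins E1 E2 \<and> joins E2 E1"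

lemma cojoins_sym: "cojoins E1 E2 \<Longrightarrow> cojoins E2 E1"
  by (simp add: cojoins_def)

lemma cojoins_refl: "cojoins E E"
  by (auto simp: cojoins_def joins_def intro: into_base)

lemma joins_one_step:
  assumes "\<And>e1. e1 \<in> E1 \<Longrightarrow> \<exists>T. rstep_s e1 T \<and> (\<forall>f\<in>T. \<exists>e2\<in>E2. rred\<^sup>*\<^sup>* e2 f)"
  shows "joins E1 E2"
  unfolding joins_def
proof
  fix e1 assume "e1 \<in> E1"
  then obtain T where "rstep_s e1 T" "\<forall>f\<in>T. \<exists>e2\<in>E2. rred\<^sup>*\<^sup>* e2 f" using assms by blast
  then show "reduces_into (\<lambda>f. \<exists>e2\<in>E2. rred\<^sup>*\<^sup>* e2 f) e1"
    by (intro into_step[of e1 T] ballI into_base) auto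
qed

lemma cojoins_one_step:
  assumes "\<And>e1. e1 \<in> E1 \<Longrightarrow> \<exists>T. rstep_s e1 T \<and> (\<forall>f\<in>T. \<exists>e2\<in>E2. rred e2 f)"
    and "\<And>e2. e2 \<in> E2 \<Longrightarrow> \<exists>T. rstep_s e2 T \<and> (\<forall>f\<in>T. \<exists>e1\<in>E1. rred e1 f)"
  shows "cojoins E1 E2"
  unfolding cojoins_def using assms by (auto intro!: joins_one_step) (meson r_into_rtranclp)+

lemma joins_ctx:
  assumes "joins E1 E2" "rctx C"
  shows "joins (C ` E1) (C ` E2)"
proof -
  have "reduces_into (\<lambda>f. \<exists>e2\<in>C ` E2. rred\<^sup>*\<^sup>* e2 f) (C e1)" if "e1 \<in> E1" for e1
  proof (rule reduces_into_ctx[OF _ assms(2)])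
    show "reduces_into (\<lambda>f. \<exists>e2\<in>E2. rred\<^sup>*\<^sup>* e2 f) e1" using assms(1) that by (simp add: joins_def)
  qed (use rctx_rreds[OF assms(2)] in blast)
  then show ?thesis by (simp add: joins_def)
qed

lemma cojoins_ctx:
  assumes "cojoins E1 E2" "rctx C"
  shows "cojoins (C ` E1) (C ` E2)"
  using assms by (simp add: cojoins_def joins_ctx)

text \<open>Steps in disjoint positions: each result of one step performs the other. If one of the
  result sets is empty, the members of the other one step to the empty set.\<close>

lemma cojoins_commute:
  assumes "\<And>t. rctx (\<lambda>x. F x t)" "\<And>s. rctx (F s)" "rstep_s s S" "rstep_s t T"
  shows "cojoins ((\<lambda>s. F s t) ` S) (F s ` T)"
proof (rule cojoins_one_step)
  fix e assume "e \<in> (\<lambda>s. F s t) ` S"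
  then obtain s' where s': "e = F s' t" "s' \<in> S" by blast
  have "rstep_s (F s' t) (F s' ` T)" using assms by (simp add: rctx_def)
  moreover have "rred (F s t') (F s' t')" for t'
    using assms(1,3) s'(2) by (auto intro: rctx_rred[where C = "\<lambda>x. F x t'"] rredI)
  ultimately show "\<exists>E. rstep_s e E \<and> (\<forall>f\<in>E. \<exists>e2\<in>F s ` T. rred e2 f)" using s' by blast
next
  fix e assume "e \<in> F s ` T"
  then obtain t' where t': "e = F s t'" "t' \<in> T" by blast
  have "rstep_s (F s t') ((\<lambda>s. F s t') ` S)" using assms by (simp add: rctx_def)
  moreover have "rred (F s' t) (F s' t')" for s'
    using assms(2,4) t'(2) by (auto intro: rctx_rred[where C = "F s'"] rredI)
  ultimately show "\<exists>E. rstep_s e E \<and> (\<forall>f\<in>E. \<exists>e2\<in>(\<lambda>s. F s t) ` S. rred e2 f)" using t' by blast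
qed

text \<open>A sigma rule moves its subterms without copying or erasing them. So a root step and a
  step in a subterm can be exchanged with one step on each side.\<close>

lemma cojoins_root:
  assumes "rctx D" "rstep_s x X" "\<And>y. rstep_s (C y) {D y}"
  shows "cojoins {D x} (C ` X)"
proof (rule cojoins_one_step)
  fix e assume "e \<in> {D x}"
  then have "rstep_s e (D ` X)" using assms by (simp add: rctx_def)
  moreover have "rred (C y) (D y)" for y using assms(3) by (blast intro: rredI)
  ultimately show "\<exists>E. rstep_s e E \<and> (\<forall>f\<in>E. \<exists>e2\<in>C ` X. rred e2 f)" by blast
next
  fix e assume "e \<in> C ` X"
  then obtain y where y: "e = C y" "y \<in> X" by blast
  have "rred (D x) (D y)" using assms y by (auto intro: rctx_rred rredI)
  then show "\<exists>E. rstep_s e E \<and> (\<forall>f\<in>E. \<exists>e2\<in>{D x}. rred e2 f)" using assms(3) y by blast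
qed

text \<open>Serves the overlaps of sigma with beta, where the sigma step only delays the beta step:
  contracting it afterwards yields exactly the other result set.\<close>

lemma cojoins_step_eq:
  assumes "rstep_s e E"
  shows "cojoins {e} E"
proof -
  have "joins {e} E" using assms by (auto intro!: joins_one_step)
  moreover have "joins E {e}" using assms by (auto simp: joins_def intro: into_base rredI)
  ultimately show ?thesis by (simp add: cojoins_def)
qed

lemma cojoins_one_two:
  assumes "rstep_s e {z}" "rstep_s e' {y}" "rstep_s y {z}"
  shows "cojoins {e} {e'}"
proof -
  have "rred e z" "rred e' y" "rred y z" using assms by (auto intro: rredI)
  then have "rred\<^sup>*\<^sup>* e z" "rred\<^sup>*\<^sup>* e' z" by auto
  moreover have "reduces_into P e" "reduces_into P e'" if "P z" for P
    using into_step[OF assms(1), of P] into_step[OF assms(2), of P] into_step[OF assms(3), of P]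
      into_base[of P, OF that] by auto
  ultimately show ?thesis unfolding cojoins_def joins_def by simp
qed

section \<open>Overlaps at the root, rule by rule\<close>

lemma rred_beta: "t' \<in> lsubst t vs \<Longrightarrow> rred (RA (RB {#RL t#}) (RB vs)) t'"
  by (rule rredI[OF r_beta])

lemma cojoins_beta:
  assumes "rstep_s (RA (RB {#RL t#}) (RB vs)) E"
  shows "cojoins (lsubst t vs) E"
  using assms
proof cases
  case r_beta
  then show ?thesis by (simp add: cojoins_refl)
next
  case r_zero
  then show ?thesis by simp
next
  case (r_appl S)
  from this(2) obtain T where T: "rstep_s t T" "S = (\<lambda>t'. RB {#RL t'#}) ` T"
    by (auto elim!: rstep_s_RB_cases)
  then have E: "E = (\<lambda>t'. RA (RB {#RL t'#}) (RB vs)) ` T" using r_appl(1) by (simp add: image_image)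
  show ?thesis
  proof (rule cojoins_one_step)
    fix e assume "e \<in> lsubst t vs"
    then obtain T' where "rstep_s e T'" "\<forall>f\<in>T'. \<exists>t2\<in>T. f \<in> lsubst t2 vs"
      using rstep_s_lsubst[OF T(1)] by (fastforce simp: lsubst_def)
    then show "\<exists>T'. rstep_s e T' \<and> (\<forall>f\<in>T'. \<exists>e2\<in>E. rred e2 f)"
      unfolding E by (meson imageI rred_beta)
  next
    fix e assume "e \<in> E"
    then obtain t' where t': "t' \<in> T" "e = RA (RB {#RL t'#}) (RB vs)" using E by auto
    have "\<exists>e1\<in>lsubst t vs. rred e1 f" if "f \<in> lsubst t' vs" for f
      using rstep_s_lsubst_back[OF T(1) t'(1), of 0 vs f] that by (auto simp: lsubst_def)
    then show "\<exists>T'. rstep_s e T' \<and> (\<forall>f\<in>T'. \<exists>e2\<in>lsubst t vs. rred e2 f)"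
      using t' r_beta by blast
  qed
next
  case (r_appr S)
  from this(2) obtain v b V where V: "vs = add_mset v b" "rstep_v v V" "S = (\<lambda>v'. RB (add_mset v' b)) ` V"
    by cases auto
  then have E: "E = (\<lambda>v'. RA (RB {#RL t#}) (RB (add_mset v' b))) ` V"
    using r_appr(1) by (simp add: image_image)
  show ?thesis
  proof (rule cojoins_one_step)
    fix e assume "e \<in> lsubst t vs"
    then obtain T' where "rstep_s e T'" "\<forall>f\<in>T'. \<exists>v'\<in>V. f \<in> lsubst t (add_mset v' b)"
      using lsubst_rstep_v(2)[OF _ _ V(2), of 0 vs t e] V(1) by (fastforce simp: lsubst_def)
    then show "\<exists>T'. rstep_s e T' \<and> (\<forall>f\<in>T'. \<exists>e2\<in>E. rred e2 f)"
      unfolding E by (meson imageI rred_beta)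
  next
    fix e assume "e \<in> E"
    then obtain v' where v': "v' \<in> V" "e = RA (RB {#RL t#}) (RB (add_mset v' b))" using E by auto
    have "\<exists>e1\<in>lsubst t vs. rred e1 f" if "f \<in> lsubst t (add_mset v' b)" for f
      using lsubst_rstep_v_back(2)[OF _ _ v'(1) V(2), of 0 "add_mset v' b" t f] that V(1)
      by (auto simp: lsubst_def rred_def)
    then show "\<exists>T'. rstep_s e T' \<and> (\<forall>f\<in>T'. \<exists>e2\<in>lsubst t vs. rred e2 f)"
      using v' r_beta by blast
  qed
qed

text \<open>A step inside either component leaves the size of the head bag unchanged, so each reduct
  is still a zero-redex.\<close>

lemma cojoins_zero:
  assumes "rstep_s (RA (RB b) t) E" "size b \<noteq> 1"
  shows "cojoins {} E"
proof -
  have "\<exists>c s. e = RA (RB c) s \<and> size c \<noteq> 1" if "e \<in> E" for e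
    using assms(1)
  proof cases
    case (r_appl S)
    from this(2) show ?thesis using that r_appl(1) assms(2) by (auto elim!: rstep_s_RB_cases)
  next
    case (r_appr S)
    then show ?thesis using that assms(2) by auto
  qed (use that assms(2) in auto)
  then show ?thesis unfolding cojoins_def joins_def by (blast intro: into_step r_zero)
qed

lemma cojoins_sigma1:
  assumes "rstep_s (RA (RA (RB {#RL t#}) s1) s2) E"
  shows "cojoins {RA (RB {#RL (RA t (rlift_s 0 s2))#}) s1} E" (is "cojoins {?e} E")
  using assms
proof cases
  case r_sigma1
  then show ?thesis by (simp add: cojoins_refl)
next
  case (r_appr S)
  show ?thesis unfolding r_appr(1)
      by (rule cojoins_root[where D = "\<lambda>x. RA (RB {#RL (RA t (rlift_s 0 x))#}) s1"
        and C = "RA (RA (RB {#RL t#}) s1)"])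
        (intro rctx_intros, rule r_appr(2), rule rstep_v_rstep_s.r_sigma1)
next
  case (r_appl S)
  from this(2) show ?thesis
  proof cases
    case (r_beta u vs)
    \<comment> \<open>The lifted \<open>s2\<close> does not contain the bound variable and absorbs
      no values, so substituting before or after it has been moved into the body gives the same
      set.\<close>
    have "E = lsubst (RA t (rlift_s 0 s2)) vs"
      using r_appl(1) r_beta by (auto simp: lsubst_def lsubst_rlift_same)
    then show ?thesis using r_beta rstep_v_rstep_s.r_beta cojoins_step_eq by blast
  next
    case (r_sigma3 v u s)
    \<comment> \<open>The common reduct: a single sigma3 step from \<open>?e\<close>, but two sigma1
      steps from \<open>?e'\<close>, at the root and then under the new abstraction.\<close>
    let ?z = "RA (RB {#RL (RA (RB {#RL (RA (rlift_s 1 t) (rlift_s 0 (rlift_s 0 s2)))#}) u)#}) s"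
    let ?C = "\<lambda>x. RA (RB {#RL x#}) s"
    let ?e' = "RA (RA (RB {#RL (RA (RB {#rlift_v 0 (RL t)#}) u)#}) s) s2"
    have E: "E = {?e'}" using r_appl(1) r_sigma3 by auto
    have 1: "rstep_s ?e {?z}"
      using rstep_v_rstep_s.r_sigma3[of "RL (RA t (rlift_s 0 s2))" u s] r_sigma3
      by (simp add: rlift_rlift)
    have 2: "rstep_s ?e' {?C (RA (RA (RB {#RL (rlift_s 1 t)#}) u) (rlift_s 0 s2))}"
      using rstep_v_rstep_s.r_sigma1[of "RA (RB {#rlift_v 0 (RL t)#}) u" s s2] by simp
    have 3: "rstep_s (?C (RA (RA (RB {#RL (rlift_s 1 t)#}) u) (rlift_s 0 s2))) {?z}"
      using rctx_appl[OF rctx_bag[OF rctx_id], of "{#}" s]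
        rstep_v_rstep_s.r_sigma1[of "rlift_s 1 t" u "rlift_s 0 s2"]
      unfolding rctx_def by fastforce
    show ?thesis unfolding E using 1 2 3 by (rule cojoins_one_two)
  next
    case (r_appl S')
    from this(2) obtain T where T: "rstep_s t T" "S' = (\<lambda>t'. RB {#RL t'#}) ` T"
      by (auto elim!: rstep_s_RB_cases)
    have E: "E = (\<lambda>t'. RA (RA (RB {#RL t'#}) s1) s2) ` T"
      using T \<open>E = _\<close> r_appl(1) by (simp add: image_image)
    show ?thesis unfolding E
      by (rule cojoins_root[where D = "\<lambda>x. RA (RB {#RL (RA x (rlift_s 0 s2))#}) s1"
        and C = "\<lambda>x. RA (RA (RB {#RL x#}) s1) s2"])
        (intro rctx_intros, rule T(1), rule rstep_v_rstep_s.r_sigma1)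
  next
    case (r_appr S')
    have E: "E = (\<lambda>x. RA (RA (RB {#RL t#}) x) s2) ` S'"
      using \<open>E = _\<close> r_appr(1) by (simp add: image_image)
    show ?thesis unfolding E
      by (rule cojoins_root[where D = "\<lambda>x. RA (RB {#RL (RA t (rlift_s 0 s2))#}) x"
        and C = "\<lambda>x. RA (RA (RB {#RL t#}) x) s2"])
        (intro rctx_intros, rule r_appr(2), rule rstep_v_rstep_s.r_sigma1)
  qed simp
qed

lemma cojoins_sigma3:
  assumes "rstep_s (RA (RB {#v#}) (RA (RB {#RL t#}) s)) E"
  shows "cojoins {RA (RB {#RL (RA (RB {#rlift_v 0 v#}) t)#}) s} E" (is "cojoins {?e} E")
  using assms
proof cases
  case r_zero
  then show ?thesis by simp
next
  case r_sigma3
  then show ?thesis by (simp add: cojoins_refl)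
next
  case (r_appl S)
  from this(2) obtain u U where U: "v = RL u" "rstep_s u U" "S = (\<lambda>t'. RB {#RL t'#}) ` U"
    by (auto elim!: rstep_s_RB_cases)
  have E: "E = (\<lambda>x. RA (RB {#RL x#}) (RA (RB {#RL t#}) s)) ` U"
    using U r_appl(1) by (simp add: image_image)
  have "rstep_s (RA (RB {#RL x#}) (RA (RB {#RL t#}) s))
    {RA (RB {#RL (RA (RB {#RL (rlift_s (Suc 0) x)#}) t)#}) s}" for x
    using rstep_v_rstep_s.r_sigma3[of "RL x" t s] by simp
  then show ?thesis unfolding E U(1) rlift_v.simps
    by (intro cojoins_root[where D = "\<lambda>x. RA (RB {#RL (RA (RB {#RL (rlift_s (Suc 0) x)#}) t)#}) s"
        and C = "\<lambda>x. RA (RB {#RL x#}) (RA (RB {#RL t#}) s)"] rctx_intros U(2))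
next
  case (r_appr S)
  from this(2) show ?thesis
  proof cases
    case (r_beta u vs)
    have "lsubst (RA (RB {#rlift_v 0 v#}) t) vs = (\<lambda>t'. RA (RB {#v#}) t') ` lsubst t vs"
      by (auto simp: lsubst_def lsubst_rlift_same simp del: lsubst_s_RB_add_iff)
    then have "E = lsubst (RA (RB {#rlift_v 0 v#}) t) vs"
      using r_appr(1) r_beta by simp
    then show ?thesis using r_beta rstep_v_rstep_s.r_beta cojoins_step_eq by blast
  next
    case (r_sigma3 w u s')
    \<comment> \<open>The common reduct: a single sigma3 step from \<open>?e\<close>, and two from
      \<open>?e'\<close>, at the root and then under the new abstraction.\<close>
    let ?z = "RA (RB {#RL (RA (RB {#RL (RA (RB {#rlift_v 0 (rlift_v 0 v)#}) (rlift_s 1 t))#}) u)#}) s'"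
    let ?C = "\<lambda>x. RA (RB {#RL x#}) s'"
    let ?e' = "RA (RB {#v#}) (RA (RB {#RL (RA (RB {#RL (rlift_s 1 t)#}) u)#}) s')"
    have E: "E = {?e'}" using r_appr(1) r_sigma3 by auto
    have 1: "rstep_s ?e {?z}"
      using rstep_v_rstep_s.r_sigma3[of "RL (RA (RB {#rlift_v 0 v#}) t)" u s'] r_sigma3
      by (simp add: rlift_rlift)
    have 2: "rstep_s ?e' {?C (RA (RB {#rlift_v 0 v#}) (RA (RB {#RL (rlift_s 1 t)#}) u))}"
      using rstep_v_rstep_s.r_sigma3 by simp
    have 3: "rstep_s (?C (RA (RB {#rlift_v 0 v#}) (RA (RB {#RL (rlift_s 1 t)#}) u))) {?z}"
      using rctx_appl[OF rctx_bag[OF rctx_id], of "{#}" s']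
        rstep_v_rstep_s.r_sigma3[of "rlift_v 0 v" "rlift_s 1 t" u]
      unfolding rctx_def by fastforce
    show ?thesis unfolding E using 1 2 3 by (rule cojoins_one_two)
  next
    case (r_appl S')
    from this(2) obtain T where T: "rstep_s t T" "S' = (\<lambda>t'. RB {#RL t'#}) ` T"
      by (auto elim!: rstep_s_RB_cases)
    have E: "E = (\<lambda>t'. RA (RB {#v#}) (RA (RB {#RL t'#}) s)) ` T"
      using T \<open>E = _\<close> r_appl(1) by (simp add: image_image)
    show ?thesis unfolding E
      by (rule cojoins_root[where D = "\<lambda>x. RA (RB {#RL (RA (RB {#rlift_v 0 v#}) x)#}) s"
        and C = "\<lambda>x. RA (RB {#v#}) (RA (RB {#RL x#}) s)"])
        (intro rctx_intros, rule T(1), rule rstep_v_rstep_s.r_sigma3)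
  next
    case (r_appr S')
    have E: "E = (\<lambda>x. RA (RB {#v#}) (RA (RB {#RL t#}) x)) ` S'"
      using \<open>E = _\<close> r_appr(1) by (simp add: image_image)
    show ?thesis unfolding E
      by (rule cojoins_root[where D = "\<lambda>x. RA (RB {#RL (RA (RB {#rlift_v 0 v#}) t)#}) x"
        and C = "\<lambda>x. RA (RB {#v#}) (RA (RB {#RL t#}) x)"])
        (intro rctx_intros, rule r_appr(2), rule rstep_v_rstep_s.r_sigma3)
  qed simp
qed

lemma local_confluence:
  assumes "rstep_s e E1" "rstep_s e E2"
  shows "cojoins E1 E2"
  using assms
proof (induction arbitrary: E2 rule: rstep_s_induct)
  case (beta t vs)
  then show ?case by (rule cojoins_beta)
next
  case (zero b t)
  then show ?case by (simp add: cojoins_zero)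
next
  case (sigma1 t s1 s2)
  then show ?case by (rule cojoins_sigma1)
next
  case (sigma3 v t s)
  then show ?case by (rule cojoins_sigma3)
next
  case (appl s S t)
  note step = rstep_v_rstep_s.r_appl[OF appl.hyps, of t]
  from appl.prems show ?case
  proof cases
    case (r_beta u vs)
    then show ?thesis using cojoins_beta step cojoins_sym by metis
  next
    case (r_zero b)
    then show ?thesis using cojoins_zero step cojoins_sym by metis
  next
    case (r_sigma1 u s1)
    then show ?thesis using cojoins_sigma1 step cojoins_sym by metis
  next
    case (r_sigma3 v u s')
    then show ?thesis using cojoins_sigma3 step cojoins_sym by metis
  next
    case (r_appl S')
    then show ?thesis using cojoins_ctx[OF appl.IH rctx_appl[OF rctx_id]] by simp
  next
    case (r_appr T)
    then show ?thesis using cojoins_commute[of RA, OF _ _ appl.hyps] by (simp add: rctx_intros)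
  qed
next
  case (appr t T s)
  note step = rstep_v_rstep_s.r_appr[OF appr.hyps, of s]
  from appr.prems show ?case
  proof cases
    case (r_beta u vs)
    then show ?thesis using cojoins_beta step cojoins_sym by metis
  next
    case (r_zero b)
    then show ?thesis using cojoins_zero step cojoins_sym by metis
  next
    case (r_sigma1 u s1)
    then show ?thesis using cojoins_sigma1 step cojoins_sym by metis
  next
    case (r_sigma3 v u s')
    then show ?thesis using cojoins_sigma3 step cojoins_sym by metis
  next
    case (r_appl S)
    then show ?thesis using cojoins_commute[of RA, OF _ _ _ appr.hyps] cojoins_sym by (simp add: rctx_intros)
  next
    case (r_appr T')
    then show ?thesis using cojoins_ctx[OF appr.IH rctx_appr[OF rctx_id]] by simp
  qed
next
  case (bag t T b)
  from bag.prems obtain u c U where U: "add_mset (RL t) b = add_mset (RL u) c" "rstep_s u U"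
    "E2 = (\<lambda>t'. RB (add_mset (RL t') c)) ` U" by (rule rstep_s_RB_cases)
  from U(1) consider "t = u" "b = c" | d where "b = add_mset (RL u) d" "c = add_mset (RL t) d"
    by (auto simp: add_eq_conv_ex)
  then show ?case
  proof cases
    case 1
    then show ?thesis using cojoins_ctx[OF bag.IH rctx_bag[OF rctx_id]] U by simp
  next
    case 2
    have "rctx (\<lambda>x. RB (add_mset (RL x) (add_mset (RL y) d)))"
      "rctx (\<lambda>y. RB (add_mset (RL x) (add_mset (RL y) d)))" for x y
      using rctx_bag[OF rctx_id, of "add_mset (RL x) d"]
      by (auto intro: rctx_intros simp: add_mset_commute)
    from cojoins_commute[where F = "\<lambda>x y. RB (add_mset (RL x) (add_mset (RL y) d))", OF this bag.hyps U(2)]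
    show ?thesis using 2 U(3) by (simp add: add_mset_commute)
  qed
qed

section \<open>Termination and normal forms\<close>

text \<open>A variable counts 0, so filling an occurrence with \<open>v\<close> adds exactly the
  size of \<open>v\<close>. A beta step then loses exactly the application and the
  abstraction.\<close>

primrec rsz_v :: "rval \<Rightarrow> nat" and rsz_s :: "rsimp \<Rightarrow> nat" where
  "rsz_v (RV n) = 0"
| "rsz_v (RL t) = Suc (rsz_s t)"
| "rsz_s (RA s t) = Suc (rsz_s s + rsz_s t)"
| "rsz_s (RB b) = sum_mset (image_mset rsz_v b)"

text \<open>Linear substitution makes the beta rule decrease the size. The sigma rules preserve it, but
  decrease the following weight, because \<open>(t + 2) \<cdot> s\<^sub>1 \<cdot> s\<^sub>2 > (t \<cdot> s\<^sub>2 + 2) \<cdot> s\<^sub>1\<close> when \<open>s\<^sub>2 \<ge> 2\<close>.\<close>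

primrec rwt_v :: "rval \<Rightarrow> nat" and rwt_s :: "rsimp \<Rightarrow> nat" where
  "rwt_v (RV n) = 0"
| "rwt_v (RL t) = rwt_s t"
| "rwt_s (RA s t) = rwt_s s * rwt_s t"
| "rwt_s (RB b) = 2 + sum_mset (image_mset rwt_v b)"

lemma rsz_rlift [simp]: "rsz_v (rlift_v k u) = rsz_v u" "rsz_s (rlift_s k t) = rsz_s t"
  by (induction u and t arbitrary: k and k rule: rterm_induct) auto

lemma rwt_rlift [simp]: "rwt_v (rlift_v k u) = rwt_v u" "rwt_s (rlift_s k t) = rwt_s t"
  by (induction u and t arbitrary: k and k rule: rterm_induct) auto

text \<open>The reason for the summand 2 in the weight of a bag: a sigma1 step lowers the weight by
  twice \<open>s1 * s2 - s1\<close> (in weights), which is positive only if \<open>s2\<close> weighs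
  at least 2. Positivity also makes the product strictly monotone in both factors.\<close>

lemma rwt_ge_2: "2 \<le> rwt_s t"
proof -
  have "True" "2 \<le> rwt_s t"
  proof (induction rule: rterm_induct)
    case (RA s t)
    then show ?case using mult_le_mono[of 1 "rwt_s s" 2 "rwt_s t"] by simp
  qed auto
  then show ?thesis by simp
qed

lemma rsz_lsubst:
  "lsubst_v k vs u u' \<Longrightarrow> rsz_v u' = rsz_v u + sum_mset (image_mset rsz_v vs)"
  "lsubst_s k vs t t' \<Longrightarrow> rsz_s t' = rsz_s t + sum_mset (image_mset rsz_v vs)"
proof (induction rule: lsubst_v_lsubst_s.inducts)
  case (ls_hit k v)
  have "rsz_v ((rlift_v 0 ^^ k) v) = rsz_v v" by (induction k) auto
  then show ?case by simp
qed auto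

lemma rstep_s_decreases:
  assumes "rstep_s t T" "t' \<in> T"
  shows "rsz_s t' < rsz_s t \<or> rsz_s t' = rsz_s t \<and> rwt_s t' < rwt_s t"
  using assms
proof (induction arbitrary: t' rule: rstep_s_induct)
  case (beta t vs)
  then show ?case by (auto simp: lsubst_def rsz_lsubst(2))
next
  case (sigma1 t s1 s2)
  have lt: "rwt_s s1 < rwt_s s1 * rwt_s s2" using rwt_ge_2[of s1] rwt_ge_2[of s2] by simp
  show ?case using sigma1 add_strict_mono[OF lt lt] by (auto simp: algebra_simps)
next
  case (sigma3 v t s)
  have "0 < rwt_s s" using rwt_ge_2[of s] by simp
  then show ?case using sigma3 by (auto simp: algebra_simps)
next
  case (appl s S t)
  then show ?case using rwt_ge_2[of t] by fastforce
next
  case (appr t T s)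
  then show ?case using rwt_ge_2[of s] by fastforce
qed fastforce+

definition rless :: "(rsimp \<times> rsimp) set" where
  "rless = inv_image (less_than <*lex*> less_than) (\<lambda>t. (rsz_s t, rwt_s t))"

lemma wf_rless: "wf rless"
  unfolding rless_def by (intro wf_inv_image wf_lex_prod wf_less_than)

lemma trans_rless: "trans rless"
  unfolding rless_def by (intro trans_inv_image trans_lex_prod trans_less_than)

lemma rred_rless: "rred t t' \<Longrightarrow> (t', t) \<in> rless"
  using rstep_s_decreases by (auto simp: rred_def rless_def)

section \<open>Persistence of normal forms, and the identification of \<open>nf\<close>\<close>

definition rnormal :: "rsimp \<Rightarrow> bool" where
  "rnormal t \<longleftrightarrow> (\<nexists>T. rstep_s t T)"

text \<open>Takes the place of Newman's lemma. Let \<open>e\<close> be the first term after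
  \<open>t\<close> on the path to \<open>n\<close>. Local confluence gives a tree below
  \<open>e\<close> whose leaves are reached from \<open>T\<close>; by induction each step of the
  tree keeps \<open>n\<close> reachable from some successor, so \<open>n\<close> is reached from
  some leaf and hence from \<open>T\<close>.\<close>

lemma normal_form_preserved:
  assumes "rstep_s t T" "rred\<^sup>*\<^sup>* t n" "rnormal n"
  shows "\<exists>t'\<in>T. rred\<^sup>*\<^sup>* t' n"
  using assms
proof (induction t arbitrary: T rule: wf_induct_rule[OF wf_rless])
  case (1 t)
  have "t \<noteq> n" using 1 by (auto simp: rnormal_def)
  then obtain e E where e: "rstep_s t E" "e \<in> E" "rred\<^sup>*\<^sup>* e n"
    using 1(3) by (metis converse_rtranclpE rred_def)
  have "reduces_into (\<lambda>f. \<exists>t'\<in>T. rred\<^sup>*\<^sup>* t' f) e"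
    using local_confluence[OF e(1) 1(2)] e(2) by (simp add: cojoins_def joins_def)
  moreover have "(e, t) \<in> rless" using e by (auto intro: rred_rless rredI)
  ultimately show ?case using e(3)
  proof (induction rule: reduces_into.induct)
    case (into_base x)
    then show ?case by (meson rtranclp_trans)
  next
    case (into_step x X)
    then obtain x' where x': "x' \<in> X" "rred\<^sup>*\<^sup>* x' n" using "1.IH" 1(4) by blast
    then have "(x', t) \<in> rless" using into_step.hyps into_step.prems trans_rless
      by (meson rredI rred_rless transD)
    then show ?case using into_step x' by blast
  qed
qed

text \<open>The path to \<open>n\<close> can be rerouted through a leaf of any given tree. If no
  leaf is allowed, this shows that a term reducing to the empty set reaches no normal term.\<close>

lemma normal_form_of_reduces_into:
  assumes "reduces_into P t" "rred\<^sup>*\<^sup>* t n" "rnormal n"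
  shows "\<exists>f. P f \<and> rred\<^sup>*\<^sup>* t f \<and> rred\<^sup>*\<^sup>* f n"
  using assms
proof (induction rule: reduces_into.induct)
  case (into_step t T)
  then obtain t' where "t' \<in> T" "rred\<^sup>*\<^sup>* t' n" using normal_form_preserved by blast
  moreover from this(1) have "rred t t'" using into_step.hyps by (blast intro: rredI)
  ultimately show ?case using into_step by (meson converse_rtranclp_into_rtranclp)
qed blast

lemma finite_subseteq_mset: "finite {A. A \<subseteq># B}"
proof (induction B)
  case (add x B)
  have "{A. A \<subseteq># add_mset x B} \<subseteq> {A. A \<subseteq># B} \<union> add_mset x ` {A. A \<subseteq># B}"
  proof
    fix A assume A: "A \<in> {A. A \<subseteq># add_mset x B}"
    show "A \<in> {A. A \<subseteq># B} \<union> add_mset x ` {A. A \<subseteq># B}"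
    proof (cases "x \<in># A")
      case True
      then obtain A' where "A = add_mset x A'" by (meson mset_add)
      with A show ?thesis by auto
    next
      case False
      moreover have "count A a \<le> count (add_mset x B) a" for a
        using A by (simp only: mem_Collect_eq subseteq_mset_def)
      ultimately have "A \<subseteq># B"
        by (intro mset_subset_eqI) (metis count_add_mset count_eq_zero_iff le0)
      then show ?thesis by simp
    qed
  qed
  then show ?case using add by (auto intro: finite_subset)
qed simp

text \<open>Finiteness makes the multiset order applicable in \<open>rstep_set_normalizes\<close>:
  \<open>mset_set\<close> of an infinite set would be empty.\<close>

lemma finite_lsubst:
  "finite {u'. lsubst_v k vs u u'}" "finite {t'. lsubst_s k vs t t'}"
proof (induction u and t arbitrary: k vs and k vs rule: rterm_induct)
  case (RV n)
  have "{u'. lsubst_v k vs (RV n) u'} \<subseteq> insert (RV (if n < k then n else n - 1)) ((rlift_v 0 ^^ k) ` set_mset vs)"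
    by auto
  then show ?case by (rule finite_subset) simp
next
  case (RL t)
  have "{u'. lsubst_v k vs (RL t) u'} = RL ` {t'. lsubst_s (Suc k) vs t t'}" by auto
  then show ?case using RL by simp
next
  case (RA s t)
  have "{t'. lsubst_s k vs (RA s t) t'} \<subseteq>
    (\<Union>vs1\<in>{m. m \<subseteq># vs}. \<Union>vs2\<in>{m. m \<subseteq># vs}.
      (\<lambda>(s', t'). RA s' t') ` ({s'. lsubst_s k vs1 s s'} \<times> {t'. lsubst_s k vs2 t t'}))" (is "_ \<subseteq> ?S")
  proof
    fix r assume "r \<in> {t'. lsubst_s k vs (RA s t) t'}"
    then obtain vs1 vs2 s' t' where "vs = vs1 + vs2" "r = RA s' t'" "lsubst_s k vs1 s s'" "lsubst_s k vs2 t t'"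
      by auto
    then show "r \<in> ?S" by (intro UN_I[of vs1] UN_I[of vs2]) auto
  qed
  then show ?case by (rule finite_subset) (auto intro!: RA finite_cartesian_product finite_subseteq_mset)
next
  case RB_empty
  then show ?case by simp
next
  case (RB_add u b)
  have "{t'. lsubst_s k vs (RB (add_mset u b)) t'} \<subseteq>
    (\<Union>vs1\<in>{m. m \<subseteq># vs}. \<Union>vs2\<in>{m. m \<subseteq># vs}.
      (\<lambda>(u', r). case r of RB b' \<Rightarrow> RB (add_mset u' b') | _ \<Rightarrow> r) `
      ({u'. lsubst_v k vs1 u u'} \<times> {t'. lsubst_s k vs2 (RB b) t'}))" (is "_ \<subseteq> ?S")
  proof
    fix r assume "r \<in> {t'. lsubst_s k vs (RB (add_mset u b)) t'}"
    then obtain vs1 vs2 u' b' where "vs = vs1 + vs2" "r = RB (add_mset u' b')"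
      "lsubst_v k vs1 u u'" "lsubst_s k vs2 (RB b) (RB b')" by auto
    then show "r \<in> ?S" by (intro UN_I[of vs1] UN_I[of vs2] image_eqI[of _ _ "(u', RB b')"]) auto
  qed
  then show ?case by (rule finite_subset) (auto intro!: RB_add finite_cartesian_product finite_subseteq_mset)
qed

lemma finite_rstep_s: "rstep_s t T \<Longrightarrow> finite T"
  by (induction rule: rstep_s_induct) (auto simp: lsubst_def finite_lsubst)

lemma r_normal_iff: "r_normal E \<longleftrightarrow> (\<forall>e\<in>E. rnormal e)"
proof
  assume "r_normal E"
  have "\<not> rstep_s e T" if "e \<in> E" for e T
  proof
    assume "rstep_s e T"
    then have "rstep_set (insert e (E - {e})) (T \<union> (E - {e}))" by (intro rstep_set.intros) auto
    with \<open>r_normal E\<close> that show False by (simp add: r_normal_def insert_absorb)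
  qed
  then show "\<forall>e\<in>E. rnormal e" by (auto simp: rnormal_def)
qed (auto simp: r_normal_def rnormal_def elim: rstep_set.cases)

text \<open>The invariant that determines the result of a set reduction, whatever order of steps is
  chosen.\<close>

lemma rstep_set_preserves:
  assumes "rstep_set E E'"
  shows "(\<Union>e\<in>E. {n. rred\<^sup>*\<^sup>* e n \<and> rnormal n}) = (\<Union>e\<in>E'. {n. rred\<^sup>*\<^sup>* e n \<and> rnormal n})"
  using assms
proof cases
  case (1 e E1 E2)
  have "rred\<^sup>*\<^sup>* e n \<longleftrightarrow> (\<exists>e1\<in>E1. rred\<^sup>*\<^sup>* e1 n)" if "rnormal n" for n
    using normal_form_preserved[OF 1(3) _ that] 1(3)
    by (meson converse_rtranclp_into_rtranclp rredI)
  then show ?thesis using 1 by auto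
qed

lemma rstep_set_normalizes: "finite E \<Longrightarrow> \<exists>E'. rstep_set\<^sup>*\<^sup>* E E' \<and> r_normal E'"
proof (induction "mset_set E" arbitrary: E rule: wf_induct_rule[OF wf_mult[OF wf_rless]])
  case 1
  show ?case
  proof (cases "r_normal E")
    case False
    then obtain e T where e: "e \<in> E" "rstep_s e T" by (auto simp: r_normal_iff rnormal_def)
    let ?E = "T \<union> (E - {e})"
    have "rstep_set (insert e (E - {e})) ?E" using e by (intro rstep_set.intros) auto
    then have step: "rstep_set E ?E" using e by (simp add: insert_absorb)
    have fin: "finite T" using e finite_rstep_s by blast
    have dec: "(x, e) \<in> rless" if "x \<in> T" for x using e that by (auto intro: rred_rless rredI)
    \<comment> \<open>Results that are already present merge with the old elements, so only the
      remaining ones enter the multiset in exchange for \<open>e\<close>.\<close>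
    have "mset_set ?E = mset_set (E - {e}) + mset_set (T - (E - {e}))"
      using fin 1(2) by (subst mset_set_Union[symmetric]) (auto intro: arg_cong[where f = mset_set])
    moreover have "mset_set E = mset_set (E - {e}) + {#e#}"
      using e 1(2) by (metis add_mset_add_single mset_set.remove)
    moreover have "(mset_set (E - {e}) + mset_set (T - (E - {e})), mset_set (E - {e}) + {#e#}) \<in> mult rless"
      by (rule one_step_implies_mult) (use dec fin in auto)
    ultimately have "(mset_set ?E, mset_set E) \<in> mult rless" by simp
    then have "\<exists>E'. rstep_set\<^sup>*\<^sup>* ?E E' \<and> r_normal E'" using 1 fin by blast
    then show ?thesis using step by (meson converse_rtranclp_into_rtranclp)
  qed blast
qed

text \<open>A normal set consists of the normal terms reachable from it, so the invariant forces the
  value of the definite description; its existence is \<open>rstep_set_normalizes\<close>.\<close>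

lemma nf_eq: "nf e = {n. rred\<^sup>*\<^sup>* e n \<and> rnormal n}"
proof -
  have eq: "E = {n. rred\<^sup>*\<^sup>* e n \<and> rnormal n}" if "rstep_set\<^sup>*\<^sup>* {e} E" "r_normal E" for E
  proof -
    have "(\<Union>x\<in>{e}. {n. rred\<^sup>*\<^sup>* x n \<and> rnormal n}) = (\<Union>x\<in>E. {n. rred\<^sup>*\<^sup>* x n \<and> rnormal n})"
      using that(1)
    proof (induction rule: rtranclp_induct)
      case (step E E')
      from step.IH rstep_set_preserves[OF step.hyps(2)] show ?case by (rule trans)
    qed simp
    moreover have "{n. rred\<^sup>*\<^sup>* x n \<and> rnormal n} = {x}" if "x \<in> E" for x
    proof -
      have "rnormal x" using that \<open>r_normal E\<close> by (simp add: r_normal_iff)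
      moreover from this have "n = x" if "rred\<^sup>*\<^sup>* x n" for n
        using that by (metis converse_rtranclpE rnormal_def rred_def)
      ultimately show ?thesis by auto
    qed
    ultimately show ?thesis by auto
  qed
  show ?thesis unfolding nf_def
  proof (rule the_equality)
    obtain E where "rstep_set\<^sup>*\<^sup>* {e} E" "r_normal E" using rstep_set_normalizes[of "{e}"] by auto
    with eq[OF this] show "rstep_set\<^sup>*\<^sup>* {e} {n. rred\<^sup>*\<^sup>* e n \<and> rnormal n} \<and> r_normal {n. rred\<^sup>*\<^sup>* e n \<and> rnormal n}"
      by simp
  qed (use eq in simp)
qed

section \<open>Taylor expansion and reduction\<close>

text \<open>Unifies the two value clauses of \<open>taylor\<close>: the expansion of a value
  consists of all finite bags over this set. It also supplies the resource values that linear
  substitution puts in place of a variable.\<close>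

fun taylor_v :: "lterm \<Rightarrow> rval set" where
  "taylor_v (Var x) = {RV x}"
| "taylor_v (Lam M) = RL ` taylor M"
| "taylor_v (App M N) = {}"

lemma set_mset_subset_image:
  "set_mset b \<subseteq> f ` S \<longleftrightarrow> (\<exists>c. b = image_mset f c \<and> set_mset c \<subseteq> S)"
proof
  assume "set_mset b \<subseteq> f ` S"
  then show "\<exists>c. b = image_mset f c \<and> set_mset c \<subseteq> S"
  proof (induction b)
    case (add x b)
    then obtain c y where "b = image_mset f c" "set_mset c \<subseteq> S" "x = f y" "y \<in> S" by auto
    then show ?case by (intro exI[of _ "add_mset y c"]) simp
  qed simp
qed (auto simp: image_mono subset_image_iff)

lemma taylor_value: "is_val V \<Longrightarrow> taylor V = {RB b | b. set_mset b \<subseteq> taylor_v V}"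
proof (cases V)
  case (Var x)
  then show ?thesis by (auto dest: set_mset_subset_singletonD)
next
  case (Lam M)
  have "(\<exists>ts. b = mset (map RL ts) \<and> (\<forall>t\<in>set ts. t \<in> taylor M)) \<longleftrightarrow> set_mset b \<subseteq> RL ` taylor M" for b
    unfolding set_mset_subset_image by (metis ex_mset mset_map set_mset_mset subset_code(1))
  then show ?thesis using Lam by auto
qed simp

lemma taylor_RB_is_val: "RB b \<in> taylor M \<Longrightarrow> is_val M"
  by (cases M) auto

text \<open>The conjunct \<open>is_val M\<close> excludes the empty bag for applications, where
  \<open>taylor_v\<close> is empty and the inclusion alone would hold.\<close>

lemma RB_in_taylor_iff: "RB b \<in> taylor M \<longleftrightarrow> is_val M \<and> set_mset b \<subseteq> taylor_v M"
  using taylor_RB_is_val taylor_value by blast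

lemma taylor_AppE:
  assumes "t \<in> taylor (App M N)"
  obtains r s where "t = RA r s" "r \<in> taylor M" "s \<in> taylor N"
  using assms by auto

lemma taylor_valueE:
  assumes "t \<in> taylor V" "is_val V"
  obtains b where "t = RB b" "set_mset b \<subseteq> taylor_v V"
  using assms taylor_value by auto

lemma taylor_LamE:
  assumes "t \<in> taylor (Lam M)"
  obtains b where "t = RB b" "set_mset b \<subseteq> RL ` taylor M"
  using taylor_valueE[OF assms] by auto

lemma size_1_subset_image:
  assumes "size b = 1" "set_mset b \<subseteq> f ` S"
  obtains s where "b = {#f s#}" "s \<in> S"
  using assms size_1_singleton_mset[of b] by auto

lemma is_val_lift [simp]: "is_val (lift k M) = is_val M"
  by (cases M) auto

lemma taylor_v_lift_of: "taylor (lift (Suc k) M) = rlift_s (Suc k) ` taylor M \<Longrightarrow>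
    taylor_v (lift k (Lam M)) = rlift_v k ` taylor_v (Lam M)"
  by (simp add: image_image)

lemma taylor_lift_of:
  assumes "is_val V" "taylor_v (lift k V) = rlift_v k ` taylor_v V"
  shows "taylor (lift k V) = rlift_s k ` taylor V"
proof -
  have "taylor (lift k V) = {rlift_s k (RB c) | c. set_mset c \<subseteq> taylor_v V}"
    using assms by (auto simp: taylor_value set_mset_subset_image)
  also have "\<dots> = rlift_s k ` taylor V" using assms(1) by (auto simp: taylor_value simp del: rlift_s.simps)
  finally show ?thesis .
qed

lemma taylor_lift: "taylor (lift k M) = rlift_s k ` taylor M"
proof (induction M arbitrary: k)
  case (Var x)
  then show ?case by (intro taylor_lift_of) auto
next
  case (Lam M)
  show ?case by (rule taylor_lift_of[OF _ taylor_v_lift_of[OF Lam]]) simp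
next
  case (App M N)
  have "taylor (lift k (App M N)) = {rlift_s k (RA s t) | s t. s \<in> taylor M \<and> t \<in> taylor N}"
    by (auto simp: App)
  then show ?case by (auto simp del: rlift_s.simps)
qed

lemma taylor_v_lift: "taylor_v (lift k M) = rlift_v k ` taylor_v M"
  by (cases M) (auto simp: taylor_lift image_image)

lemma taylor_v_lift_pow: "taylor_v ((lift k ^^ n) M) = (rlift_v k ^^ n) ` taylor_v M"
  by (induction n) (auto simp: taylor_v_lift)

lemma is_val_lift_pow [simp]: "is_val ((lift k ^^ n) M) = is_val M"
  by (induction n) auto

lemma is_val_subst [simp]: "is_val V \<Longrightarrow> is_val (subst M k V) = is_val M"
  by (cases M) auto

text \<open>A bag is substituted element by element and the multisets consumed add up, so a
  description of the single elements carries over to bags.\<close>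

lemma bag_lsubst:
  assumes "\<And>u'. u' \<in> U' \<longleftrightarrow> (\<exists>u\<in>U. \<exists>vs. set_mset vs \<subseteq> W \<and> lsubst_v k vs u u')"
  shows "set_mset b' \<subseteq> U' \<longleftrightarrow>
    (\<exists>b vs. set_mset b \<subseteq> U \<and> set_mset vs \<subseteq> W \<and> lsubst_s k vs (RB b) (RB b'))"
proof (induction b')
  case empty
  then show ?case by auto
next
  case (add u' b')
  show ?case (is "?L = ?R")
  proof
    assume ?L
    then obtain b ws u vs where *: "set_mset b \<subseteq> U" "set_mset vs \<subseteq> W" "lsubst_s k vs (RB b) (RB b')"
      "u \<in> U" "set_mset ws \<subseteq> W" "lsubst_v k ws u u'" using add assms by auto
    show ?R
      by (rule exI[of _ "add_mset u b"], rule exI[of _ "ws + vs"])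
        (use * ls_cons in \<open>auto simp del: lsubst_s_RB_add_iff\<close>)
  next
    assume ?R
    then obtain b vs where *: "set_mset b \<subseteq> U" "set_mset vs \<subseteq> W" "lsubst_s k vs (RB b) (RB (add_mset u' b'))"
      by blast
    from lsubst_s_RB_to_add[OF *(3)] obtain vs1 vs2 u c where "vs = vs1 + vs2" "b = add_mset u c"
      "lsubst_v k vs1 u u'" "lsubst_s k vs2 (RB c) (RB b')" by blast
    then show ?L using * add assms by auto
  qed
qed

lemma taylor_subst_of:
  assumes "is_val V" "is_val M"
    "\<And>u'. u' \<in> taylor_v (subst M k ((lift 0 ^^ k) V)) \<longleftrightarrow>
      (\<exists>u\<in>taylor_v M. \<exists>vs. set_mset vs \<subseteq> taylor_v V \<and> lsubst_v k vs u u')"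
  shows "t' \<in> taylor (subst M k ((lift 0 ^^ k) V)) \<longleftrightarrow>
    (\<exists>t\<in>taylor M. \<exists>vs. set_mset vs \<subseteq> taylor_v V \<and> lsubst_s k vs t t')"
proof -
  have "t' \<in> taylor (subst M k ((lift 0 ^^ k) V)) \<longleftrightarrow>
    (\<exists>b'. t' = RB b' \<and> set_mset b' \<subseteq> taylor_v (subst M k ((lift 0 ^^ k) V)))"
    using assms(1,2) by (simp add: taylor_value)
  also have "\<dots> \<longleftrightarrow> (\<exists>b b' vs. t' = RB b' \<and> set_mset b \<subseteq> taylor_v M \<and> set_mset vs \<subseteq> taylor_v V \<and>
      lsubst_s k vs (RB b) (RB b'))"
    using bag_lsubst[OF assms(3)] by blast
  also have "\<dots> \<longleftrightarrow> (\<exists>b vs. set_mset b \<subseteq> taylor_v M \<and> set_mset vs \<subseteq> taylor_v V \<and> lsubst_s k vs (RB b) t')"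
    using lsubst_s_RB_RB by blast
  also have "\<dots> \<longleftrightarrow> (\<exists>t\<in>taylor M. \<exists>vs. set_mset vs \<subseteq> taylor_v V \<and> lsubst_s k vs t t')"
    using assms(2) by (auto simp: taylor_value)
  finally show ?thesis .
qed

text \<open>Each occurrence of the variable may receive its own element of the expansion of
  \<open>V\<close>, which is what linear substitution does. The power of \<open>lift\<close>
  reconciles two conventions: \<open>subst\<close> lifts \<open>V\<close> at every binder crossed,
  \<open>lsubst_s\<close> only on placement.\<close>

lemma taylor_subst:
  assumes "is_val V"
  shows "t' \<in> taylor (subst M k ((lift 0 ^^ k) V)) \<longleftrightarrow>
    (\<exists>t\<in>taylor M. \<exists>vs. set_mset vs \<subseteq> taylor_v V \<and> lsubst_s k vs t t')"
proof (induction M arbitrary: k t')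
  case (Var n)
  show ?case
  proof (rule taylor_subst_of[OF assms])
    fix u'
    show "u' \<in> taylor_v (subst (Var n) k ((lift 0 ^^ k) V)) \<longleftrightarrow>
      (\<exists>u\<in>taylor_v (Var n). \<exists>vs. set_mset vs \<subseteq> taylor_v V \<and> lsubst_v k vs u u')"
      by (cases "n = k") (auto simp: taylor_v_lift_pow intro: exI[of _ "{#_#}"])
  qed simp
next
  case (Lam M)
  show ?case
  proof (rule taylor_subst_of[OF assms])
    fix u'
    have "u' \<in> taylor_v (subst (Lam M) k ((lift 0 ^^ k) V)) \<longleftrightarrow>
      (\<exists>t'. u' = RL t' \<and> t' \<in> taylor (subst M (Suc k) ((lift 0 ^^ Suc k) V)))" by auto
    also have "\<dots> \<longleftrightarrow> (\<exists>u\<in>taylor_v (Lam M). \<exists>vs. set_mset vs \<subseteq> taylor_v V \<and> lsubst_v k vs u u')"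
      unfolding Lam.IH by auto
    finally show "u' \<in> taylor_v (subst (Lam M) k ((lift 0 ^^ k) V)) \<longleftrightarrow>
      (\<exists>u\<in>taylor_v (Lam M). \<exists>vs. set_mset vs \<subseteq> taylor_v V \<and> lsubst_v k vs u u')" .
  qed simp
next
  case (App M N)
  show ?case (is "?L = ?R")
  proof
    assume ?L
    then obtain r s where "t' = RA r s" "r \<in> taylor (subst M k ((lift 0 ^^ k) V))"
      "s \<in> taylor (subst N k ((lift 0 ^^ k) V))" by auto
    moreover from this App.IH obtain r' s' vs ws where *: "r' \<in> taylor M" "s' \<in> taylor N"
      "set_mset vs \<subseteq> taylor_v V" "set_mset ws \<subseteq> taylor_v V" "lsubst_s k vs r' r" "lsubst_s k ws s' s" by metis
    ultimately show ?R
      by (intro bexI[of _ "RA r' s'"] exI[of _ "vs + ws"]) (auto intro: ls_app simp del: lsubst_s_RA_iff)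
  next
    assume ?R
    then obtain r s vs where "r \<in> taylor M" "s \<in> taylor N" "set_mset vs \<subseteq> taylor_v V"
      "lsubst_s k vs (RA r s) t'" by auto
    moreover from this(4) obtain vs1 vs2 r' s' where "vs = vs1 + vs2" "t' = RA r' s'"
      "lsubst_s k vs1 r r'" "lsubst_s k vs2 s s'" by auto
    moreover from calculation have "r' \<in> taylor (subst M k ((lift 0 ^^ k) V))"
      unfolding App.IH(1) by auto
    moreover from calculation have "s' \<in> taylor (subst N k ((lift 0 ^^ k) V))"
      unfolding App.IH(2) by auto
    ultimately show ?L by simp
  qed
qed

lemma taylor_subst_0:
  "is_val V \<Longrightarrow> taylor (subst M 0 V) = (\<Union>t\<in>taylor M. \<Union>vs\<in>{vs. set_mset vs \<subseteq> taylor_v V}. lsubst t vs)"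
  using taylor_subst[of V _ M 0] by (auto simp: lsubst_def)

section \<open>Steps of terms against steps of the elements of their expansions\<close>

lemma bag_reduces_into:
  assumes "\<And>t. t \<in> S \<Longrightarrow> reduces_into (\<lambda>x. x \<in> S') t"
  shows "set_mset b \<subseteq> RL ` S \<Longrightarrow>
    reduces_into (\<lambda>x. \<exists>b'. set_mset b' \<subseteq> RL ` S' \<and> x = RB (b' + c)) (RB (b + c))"
proof (induction b arbitrary: c)
  case empty
  then show ?case by (auto intro!: into_base exI[of _ "{#}"])
next
  case (add u b)
  then obtain t where t: "u = RL t" "t \<in> S" by auto
  \<comment> \<open>The elements are treated one after the other: \<open>u\<close> is reduced first,
    and each of its results then joins the untouched part \<open>c\<close>, for which the induction
    hypothesis is general.\<close>
  have "reduces_into (\<lambda>x. \<exists>t'\<in>S'. x = RB (b + add_mset (RL t') c)) (RB (add_mset (RL t) (b + c)))"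
    by (rule reduces_into_ctx[OF assms[OF t(2)] rctx_bag[OF rctx_id]]) auto
  then have "reduces_into (\<lambda>x. \<exists>b'. set_mset b' \<subseteq> RL ` S' \<and> x = RB (b' + c)) (RB (add_mset (RL t) (b + c)))"
  proof (rule reduces_into_bind)
    fix x assume "\<exists>t'\<in>S'. x = RB (b + add_mset (RL t') c)"
    then obtain t' where t': "t' \<in> S'" "x = RB (b + add_mset (RL t') c)" by blast
    have "reduces_into (\<lambda>x. \<exists>b'. set_mset b' \<subseteq> RL ` S' \<and> x = RB (b' + add_mset (RL t') c)) x"
      unfolding t' by (rule add.IH) (use add.prems in simp)
    then show "reduces_into (\<lambda>x. \<exists>b'. set_mset b' \<subseteq> RL ` S' \<and> x = RB (b' + c)) x"
    proof (rule reduces_into_mono)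
      fix x assume "\<exists>b'. set_mset b' \<subseteq> RL ` S' \<and> x = RB (b' + add_mset (RL t') c)"
      then obtain b' where "set_mset b' \<subseteq> RL ` S'" "x = RB (add_mset (RL t') b' + c)" by auto
      then show "\<exists>b'. set_mset b' \<subseteq> RL ` S' \<and> x = RB (b' + c)" using t'
        by (intro exI[of _ "add_mset (RL t') b'"]) auto
    qed
  qed
  then show ?case using t by simp
qed

text \<open>With no leaf allowed, every branch of the tree must end in a step to the empty
  set.\<close>

abbreviation vanishes :: "rsimp \<Rightarrow> bool" where
  "vanishes \<equiv> reduces_into (\<lambda>_. False)"

lemma vanishes_ctx: "vanishes t \<Longrightarrow> rctx C \<Longrightarrow> vanishes (C t)"
  by (rule reduces_into_ctx)

lemma vanishes_zero: "size b \<noteq> 1 \<Longrightarrow> vanishes (RA (RB b) t)"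
  by (rule into_step[OF r_zero]) auto

lemma bag_rreds_back:
  assumes "\<And>t'. t' \<in> S' \<Longrightarrow> vanishes t' \<or> (\<exists>t\<in>S. rred\<^sup>*\<^sup>* t t')"
  shows "set_mset b' \<subseteq> RL ` S' \<Longrightarrow> vanishes (RB (b' + c)) \<or>
    (\<exists>b. set_mset b \<subseteq> RL ` S \<and> rred\<^sup>*\<^sup>* (RB (b + c)) (RB (b' + c)))"
proof (induction b' arbitrary: c)
  case empty
  then show ?case by (intro disjI2 exI[of _ "{#}"]) auto
next
  case (add u b')
  then obtain t' where t': "u = RL t'" "t' \<in> S'" by auto
  consider "vanishes t'" | "vanishes (RB (b' + add_mset u c))" |
    t b where "t \<in> S" "rred\<^sup>*\<^sup>* t t'" "set_mset b \<subseteq> RL ` S"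
    "rred\<^sup>*\<^sup>* (RB (b + add_mset u c)) (RB (b' + add_mset u c))"
    using assms[OF t'(2)] add.IH[of "add_mset u c"] add.prems by auto
  then show ?case
  proof cases
    case 1
    then show ?thesis using vanishes_ctx[OF 1 rctx_bag[OF rctx_id], of "b' + c"] t' by simp
  next
    case 2
    then show ?thesis by simp
  next
    case (3 t b)
    have "rred\<^sup>*\<^sup>* (RB (add_mset (RL t) (b + c))) (RB (add_mset (RL t') (b + c)))"
      by (rule rctx_rreds[OF rctx_bag[OF rctx_id] 3(2)])
    then show ?thesis using 3 t' by (intro disjI2 exI[of _ "add_mset (RL t) b"]) auto
  qed
qed

text \<open>A tree is needed rather than one step: a bag with several copies of the redex takes at
  least one step for each copy, the empty bag takes none, and a bag of size other than 1 in the
  place of a contracted abstraction makes the element reduce to the empty set.\<close>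

lemma taylor_vstep:
  assumes "vstep M N" "t \<in> taylor M"
  shows "reduces_into (\<lambda>x. x \<in> taylor N) t"
  using assms
proof (induction arbitrary: t rule: vstep.induct)
  case (beta_v V M)
  then obtain b vs where t: "t = RA (RB b) (RB vs)" "set_mset b \<subseteq> RL ` taylor M" "set_mset vs \<subseteq> taylor_v V"
    by (metis taylor_AppE taylor_LamE taylor_valueE)
  show ?case
  proof (cases "size b = 1")
    case True
    then obtain s where s: "b = {#RL s#}" "s \<in> taylor M" using t(2) by (rule size_1_subset_image)
    have "lsubst s vs \<subseteq> taylor (subst M 0 V)" using taylor_subst_0[OF beta_v(1)] s(2) t(3) by auto
    then show ?thesis unfolding t(1) s(1) by (intro into_step[OF r_beta]) (auto intro: into_base)
  next
    case False
    then show ?thesis unfolding t by (intro into_step[OF r_zero]) auto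
  qed
next
  case (sigma1 M N P)
  then obtain b s1 s2 where t: "t = RA (RA (RB b) s1) s2" "set_mset b \<subseteq> RL ` taylor M"
    "s1 \<in> taylor N" "s2 \<in> taylor P"
    by (metis taylor_AppE taylor_LamE)
  show ?case
  proof (cases "size b = 1")
    case True
    then obtain s where s: "b = {#RL s#}" "s \<in> taylor M" using t(2) by (rule size_1_subset_image)
    have "RA (RB {#RL (RA s (rlift_s 0 s2))#}) s1 \<in> taylor (App (Lam (App M (lift 0 P))) N)"
      using s(2) t(3,4) by (auto simp: RB_in_taylor_iff taylor_lift simp del: taylor.simps(2))
    then show ?thesis unfolding t(1) s(1) by (intro into_step[OF r_sigma1]) (auto intro: into_base simp del: taylor.simps)
  next
    case False
    then show ?thesis unfolding t by (intro into_step[OF r_appl[OF r_zero]]) auto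
  qed
next
  case (sigma3 V M N)
  then obtain c b s where t: "t = RA (RB c) (RA (RB b) s)" "set_mset c \<subseteq> taylor_v V" "set_mset b \<subseteq> RL ` taylor M"
    "s \<in> taylor N"
    by (metis taylor_AppE taylor_LamE taylor_valueE)
  consider v u where "c = {#v#}" "b = {#RL u#}" "u \<in> taylor M" | "size c \<noteq> 1" | "size b \<noteq> 1"
    using size_1_subset_image[OF _ t(3)] size_1_singleton_mset[of c] by metis
  then show ?case
  proof cases
    case 1
    have "RA (RB {#RL (RA (RB {#rlift_v 0 v#}) u)#}) s \<in> taylor (App (Lam (App (lift 0 V) M)) N)"
      using 1 t sigma3 by (auto simp: RB_in_taylor_iff taylor_v_lift simp del: taylor.simps(2))
    then show ?thesis unfolding t(1) 1(1,2)
      by (intro into_step[OF r_sigma3]) (auto intro: into_base simp del: taylor.simps)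
  next
    case 2
    then show ?thesis unfolding t by (intro into_step[OF r_zero]) auto
  next
    case 3
    then show ?thesis unfolding t by (intro into_step[OF r_appr[OF r_zero]]) auto
  qed
next
  case (ctx_lam M M')
  then obtain b where b: "t = RB b" "set_mset b \<subseteq> RL ` taylor M"
    by (metis taylor_LamE)
  from bag_reduces_into[where c = "{#}", OF ctx_lam.IH b(2)] show ?case unfolding b(1)
    by (auto elim!: reduces_into_mono simp: RB_in_taylor_iff simp del: taylor.simps)
next
  case (ctx_appl M M' N)
  then obtain r s where t: "t = RA r s" "r \<in> taylor M" "s \<in> taylor N" by auto
  show ?case unfolding t(1)
    by (rule reduces_into_ctx[OF ctx_appl.IH[OF t(2)] rctx_appl[OF rctx_id]]) (use t in auto)
next
  case (ctx_appr N N' M)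
  then obtain r s where t: "t = RA r s" "r \<in> taylor M" "s \<in> taylor N" by auto
  show ?case unfolding t(1)
    by (rule reduces_into_ctx[OF ctx_appr.IH[OF t(3)] rctx_appr[OF rctx_id]]) (use t in auto)
qed

lemma taylor_vsteps:
  assumes "vsteps M N" "t \<in> taylor M"
  shows "reduces_into (\<lambda>x. x \<in> taylor N) t"
  using assms
proof (induction rule: rtranclp_induct)
  case base
  then show ?case by (rule into_base)
next
  case (step N P)
  then show ?case by (blast intro: reduces_into_bind taylor_vstep)
qed

text \<open>The exception is genuine for the sigma rules: the bag of the new abstraction, or the bag
  of \<open>V\<close> moved inside, may have a size other than 1. Such an element need not come from
  \<open>M\<close>, but it contains a zero-redex and vanishes.\<close>

lemma taylor_vstep_back:
  assumes "vstep M N" "t' \<in> taylor N"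
  shows "vanishes t' \<or> (\<exists>t\<in>taylor M. rred\<^sup>*\<^sup>* t t')"
  using assms
proof (induction arbitrary: t' rule: vstep.induct)
  case (beta_v V M)
  then obtain s vs where "s \<in> taylor M" "set_mset vs \<subseteq> taylor_v V" "t' \<in> lsubst s vs"
    by (auto simp: taylor_subst_0)
  moreover from this beta_v have "RA (RB {#RL s#}) (RB vs) \<in> taylor (App (Lam M) V)"
    by (auto simp: RB_in_taylor_iff simp del: taylor.simps(2))
  ultimately show ?case by (blast intro: rred_beta)
next
  case (sigma1 M N P)
  then obtain b s1 where t: "t' = RA (RB b) s1" "set_mset b \<subseteq> RL ` taylor (App M (lift 0 P))" "s1 \<in> taylor N"
    by (metis taylor_AppE taylor_LamE)
  show ?case
  proof (cases "size b = 1")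
    case True
    then obtain r where r: "b = {#RL r#}" "r \<in> taylor (App M (lift 0 P))"
      using t(2) by (rule size_1_subset_image)
    then obtain u s2 where u: "r = RA u (rlift_s 0 s2)" "u \<in> taylor M" "s2 \<in> taylor P"
      by (auto simp: taylor_lift)
    have "RA (RA (RB {#RL u#}) s1) s2 \<in> taylor (App (App (Lam M) N) P)"
      using u t(3) by (auto simp: RB_in_taylor_iff simp del: taylor.simps(2))
    moreover have "rred (RA (RA (RB {#RL u#}) s1) s2) t'"
      unfolding t r u by (rule rredI[OF r_sigma1]) simp
    ultimately show ?thesis by blast
  qed (simp add: t vanishes_zero)
next
  case (sigma3 V M N)
  then obtain b s where t: "t' = RA (RB b) s" "set_mset b \<subseteq> RL ` taylor (App (lift 0 V) M)" "s \<in> taylor N"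
    by (metis taylor_AppE taylor_LamE)
  show ?case
  proof (cases "size b = 1")
    case True
    then obtain r where r: "b = {#RL r#}" "r \<in> taylor (App (lift 0 V) M)"
      using t(2) by (rule size_1_subset_image)
    then obtain c u where u: "r = RA (RB c) u" "set_mset c \<subseteq> rlift_v 0 ` taylor_v V" "u \<in> taylor M"
      using sigma3(1) by (metis is_val_lift taylor_AppE taylor_v_lift taylor_valueE)
    show ?thesis
    proof (cases "size c = 1")
      case True
      then obtain v where v: "c = {#rlift_v 0 v#}" "v \<in> taylor_v V"
        using u(2) by (rule size_1_subset_image)
      have "RA (RB {#v#}) (RA (RB {#RL u#}) s) \<in> taylor (App V (App (Lam M) N))"
        using u v t(3) sigma3(1) by (auto simp: RB_in_taylor_iff simp del: taylor.simps(2))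
      moreover have "rred (RA (RB {#v#}) (RA (RB {#RL u#}) s)) t'"
        unfolding t r u v by (rule rredI[OF r_sigma3]) simp
      ultimately show ?thesis by blast
    next
      case False
      then show ?thesis unfolding t r u
        using vanishes_ctx[OF vanishes_zero rctx_appl[OF rctx_bag[OF rctx_id]], of c u "{#}" s] by blast
    qed
  qed (simp add: t vanishes_zero)
next
  case (ctx_lam M M')
  then obtain b where b: "t' = RB b" "set_mset b \<subseteq> RL ` taylor M'"
    by (metis taylor_LamE)
  from bag_rreds_back[where c = "{#}", OF ctx_lam.IH b(2)] show ?case unfolding b(1)
    by (auto simp: taylor_value simp del: taylor.simps)
next
  case (ctx_appl M M' N)
  then obtain r s where t: "t' = RA r s" "r \<in> taylor M'" "s \<in> taylor N" by auto
  from ctx_appl.IH[OF t(2)] show ?case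
  proof
    assume "vanishes r"
    then show ?thesis using vanishes_ctx[OF _ rctx_appl[OF rctx_id]] t by blast
  next
    assume "\<exists>t\<in>taylor M. rred\<^sup>*\<^sup>* t r"
    then obtain r' where "r' \<in> taylor M" "rred\<^sup>*\<^sup>* r' r" by blast
    then show ?thesis using t rctx_rreds[OF rctx_appl[OF rctx_id], of r' r s] by auto
  qed
next
  case (ctx_appr N N' M)
  then obtain r s where t: "t' = RA r s" "r \<in> taylor M" "s \<in> taylor N'" by auto
  from ctx_appr.IH[OF t(3)] show ?case
  proof
    assume "vanishes s"
    then show ?thesis using vanishes_ctx[OF _ rctx_appr[OF rctx_id]] t by blast
  next
    assume "\<exists>t\<in>taylor N. rred\<^sup>*\<^sup>* t s"
    then obtain s' where "s' \<in> taylor N" "rred\<^sup>*\<^sup>* s' s" by blast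
    then show ?thesis using t rctx_rreds[OF rctx_appr[OF rctx_id], of s' s r] by auto
  qed
qed

text \<open>A term that reaches a normal form does not vanish, so the exception of
  \<open>taylor_vstep_back\<close> never occurs along the way.\<close>

lemma taylor_vsteps_normal_form_back:
  assumes "vsteps M N" "t' \<in> taylor N" "rred\<^sup>*\<^sup>* t' n" "rnormal n"
  shows "\<exists>t\<in>taylor M. rred\<^sup>*\<^sup>* t n"
  using assms(1-3)
proof (induction arbitrary: t' rule: rtranclp_induct)
  case (step N P)
  have "\<not> vanishes t'" using normal_form_of_reduces_into[OF _ step.prems(2) assms(4)] by blast
  then obtain t where "t \<in> taylor N" "rred\<^sup>*\<^sup>* t t'" using taylor_vstep_back step by blast
  then show ?case using step by (meson rtranclp_trans)
qed blast

lemma vsteps_Lam: "vsteps M N \<Longrightarrow> vsteps (Lam M) (Lam N)"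
  by (induction rule: rtranclp_induct) (auto intro: ctx_lam rtranclp.rtrancl_into_rtrancl)

lemma vsteps_appl: "vsteps M N \<Longrightarrow> vsteps (App M P) (App N P)"
  by (induction rule: rtranclp_induct) (auto intro: ctx_appl rtranclp.rtrancl_into_rtrancl)

lemma vsteps_appr: "vsteps M N \<Longrightarrow> vsteps (App P M) (App P N)"
  by (induction rule: rtranclp_induct) (auto intro: ctx_appr rtranclp.rtrancl_into_rtrancl)

text \<open>A redex of one element of the expansion is a redex of the term, up to zero-redexes, which are
  contracted without touching the term. The other elements then follow by \<open>taylor_vsteps\<close>.\<close>

lemma taylor_rstep_s:
  assumes "rstep_s t T" "t \<in> taylor M"
  shows "\<exists>N T'. vsteps M N \<and> rstep_s t T' \<and> (\<forall>x\<in>T'. reduces_into (\<lambda>x. x \<in> taylor N) x)"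
  using assms
proof (induction arbitrary: M rule: rstep_s_induct)
  case (beta t vs)
  then obtain P Q where M: "M = App P Q" "RB {#RL t#} \<in> taylor P" "RB vs \<in> taylor Q"
    by (cases M) auto
  then obtain P0 where P: "P = Lam P0" "t \<in> taylor P0" by (cases P) (auto simp: RB_in_taylor_iff simp del: taylor.simps)
  from M(3) have Q: "is_val Q" "set_mset vs \<subseteq> taylor_v Q" by (auto simp: RB_in_taylor_iff)
  have "lsubst t vs \<subseteq> taylor (subst P0 0 Q)" using taylor_subst_0[OF Q(1)] P(2) Q(2) by auto
  moreover have "vsteps M (subst P0 0 Q)" unfolding M P using Q(1) by (blast intro: beta_v)
  ultimately show ?case using r_beta by (blast intro: into_base)
next
  case (zero b t)
  then show ?case using r_zero by blast
next
  case (sigma1 t s1 s2)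
  then obtain L R where M: "M = App L R" "RA (RB {#RL t#}) s1 \<in> taylor L" "s2 \<in> taylor R"
    by (cases M) auto
  then obtain P Q where L: "L = App P Q" "RB {#RL t#} \<in> taylor P" "s1 \<in> taylor Q" by (cases L) auto
  then obtain P0 where P: "P = Lam P0" "t \<in> taylor P0"
    by (cases P) (auto simp: RB_in_taylor_iff simp del: taylor.simps)
  let ?N = "App (Lam (App P0 (lift 0 R))) Q"
  have "RA (RB {#RL (RA t (rlift_s 0 s2))#}) s1 \<in> taylor ?N"
    using M L P by (auto simp: RB_in_taylor_iff taylor_lift simp del: taylor.simps(2))
  moreover have "vsteps M ?N" unfolding M L P by (blast intro: vstep.sigma1)
  ultimately show ?case using r_sigma1[of t s1 s2] into_base by (metis (no_types, lifting) singletonD)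
next
  case (sigma3 v t s)
  then obtain V R where M: "M = App V R" "RB {#v#} \<in> taylor V" "RA (RB {#RL t#}) s \<in> taylor R"
    by (cases M) auto
  then obtain P Q where R: "R = App P Q" "RB {#RL t#} \<in> taylor P" "s \<in> taylor Q" by (cases R) auto
  then obtain P0 where P: "P = Lam P0" "t \<in> taylor P0"
    by (cases P) (auto simp: RB_in_taylor_iff simp del: taylor.simps)
  have V: "is_val V" "v \<in> taylor_v V" using M(2) by (auto simp: RB_in_taylor_iff)
  let ?N = "App (Lam (App (lift 0 V) P0)) Q"
  have "RA (RB {#RL (RA (RB {#rlift_v 0 v#}) t)#}) s \<in> taylor ?N"
    using V R P by (auto simp: RB_in_taylor_iff taylor_v_lift simp del: taylor.simps(2))
  moreover have "vsteps M ?N" unfolding M R P using V(1) by (blast intro: vstep.sigma3)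
  ultimately show ?case using r_sigma3[of v t s] into_base by (metis (no_types, lifting) singletonD)
next
  case (appl s S t)
  then obtain P Q where M: "M = App P Q" "s \<in> taylor P" "t \<in> taylor Q" by (cases M) auto
  with appl.IH obtain N T' where N: "vsteps P N" "rstep_s s T'" "\<forall>x\<in>T'. reduces_into (\<lambda>x. x \<in> taylor N) x"
    by blast
  have "reduces_into (\<lambda>x. x \<in> taylor (App N Q)) (RA x t)" if "x \<in> T'" for x
    by (rule reduces_into_ctx[OF N(3)[rule_format, OF that] rctx_appl[OF rctx_id]]) (use M in auto)
  then show ?case using vsteps_appl[OF N(1), of Q] r_appl[OF N(2), of t] M(1) by blast
next
  case (appr t T s)
  then obtain P Q where M: "M = App P Q" "s \<in> taylor P" "t \<in> taylor Q" by (cases M) auto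
  with appr.IH obtain N T' where N: "vsteps Q N" "rstep_s t T'" "\<forall>x\<in>T'. reduces_into (\<lambda>x. x \<in> taylor N) x"
    by blast
  have "reduces_into (\<lambda>x. x \<in> taylor (App P N)) (RA s x)" if "x \<in> T'" for x
    by (rule reduces_into_ctx[OF N(3)[rule_format, OF that] rctx_appr[OF rctx_id]]) (use M in auto)
  then show ?case using vsteps_appr[OF N(1), of P] r_appr[OF N(2), of s] M(1) by blast
next
  case (bag t T b)
  then obtain P where M: "M = Lam P" "t \<in> taylor P" "set_mset b \<subseteq> RL ` taylor P"
    by (cases M) (auto simp: RB_in_taylor_iff simp del: taylor.simps)
  with bag.IH obtain N T' where N: "vsteps P N" "rstep_s t T'" "\<forall>x\<in>T'. reduces_into (\<lambda>x. x \<in> taylor N) x"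
    by blast
  \<comment> \<open>The contracted copy is brought into the expansion of \<open>N\<close> first; the
    copies in \<open>b\<close> then follow while it is kept aside in the bag.\<close>
  have "reduces_into (\<lambda>x. x \<in> taylor (Lam N)) (RB (add_mset (RL x) b))" if "x \<in> T'" for x
  proof (rule reduces_into_bind)
    show "reduces_into (\<lambda>y. \<exists>t'\<in>taylor N. y = RB (b + {#RL t'#})) (RB (add_mset (RL x) b))"
      by (rule reduces_into_ctx[OF N(3)[rule_format, OF that] rctx_bag[OF rctx_id]]) auto
  next
    fix y assume "\<exists>t'\<in>taylor N. y = RB (b + {#RL t'#})"
    then obtain t' where t': "t' \<in> taylor N" "y = RB (b + {#RL t'#})" by blast
    show "reduces_into (\<lambda>x. x \<in> taylor (Lam N)) y" unfolding t'(2)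
      by (rule reduces_into_mono[OF bag_reduces_into[OF taylor_vsteps[OF N(1)] M(3)]])
        (use t' in \<open>auto simp: RB_in_taylor_iff simp del: taylor.simps\<close>)
  qed
  then show ?case using vsteps_Lam[OF N(1)] r_bag_RL[OF N(2), of b] M(1) by blast
qed

text \<open>The step supplied by \<open>taylor_rstep_s\<close> need not lie on the given path to
  \<open>n\<close>. Persistence of normal forms still leads through one of its results to a leaf in
  the expansion of a reduct of \<open>M\<close>; that leaf reaches \<open>n\<close> and is smaller
  than \<open>t\<close>.\<close>

lemma taylor_normal_form:
  assumes "t \<in> taylor M" "rred\<^sup>*\<^sup>* t n" "rnormal n"
  shows "\<exists>N. vsteps M N \<and> n \<in> taylor N"
  using assms
proof (induction t arbitrary: M rule: wf_induct_rule[OF wf_rless])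
  case (1 t)
  show ?case
  proof (cases "rnormal t")
    case True
    then have "n = t" using 1(3) by (metis converse_rtranclpE rnormal_def rred_def)
    then show ?thesis using 1(2) by blast
  next
    case False
    then obtain N T where N: "vsteps M N" "rstep_s t T" "\<forall>x\<in>T. reduces_into (\<lambda>x. x \<in> taylor N) x"
      using taylor_rstep_s 1(2) unfolding rnormal_def by blast
    obtain x where x: "x \<in> T" "rred\<^sup>*\<^sup>* x n" using normal_form_preserved[OF N(2) 1(3,4)] by blast
    then obtain f where f: "f \<in> taylor N" "rred\<^sup>*\<^sup>* x f" "rred\<^sup>*\<^sup>* f n"
      using normal_form_of_reduces_into[OF _ x(2) 1(4)] N(3) by blast
    have "rred\<^sup>+\<^sup>+ t f" using rredI[OF N(2) x(1)] f(2) by (rule rtranclp_into_tranclp2)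
    then have "(f, t) \<in> rless"
      by (induction rule: tranclp_induct) (auto intro: rred_rless transD[OF trans_rless])
    with 1(1,4) f obtain N' where "vsteps N N'" "n \<in> taylor N'" by blast
    then show ?thesis using N(1) by (meson rtranclp_trans)
  qed
qed

lemma NF_taylor: "NF (taylor M) = {n. rnormal n \<and> (\<exists>N. vsteps M N \<and> n \<in> taylor N)}"
proof (intro set_eqI iffI)
  fix n assume "n \<in> NF (taylor M)"
  then show "n \<in> {n. rnormal n \<and> (\<exists>N. vsteps M N \<and> n \<in> taylor N)}"
    using taylor_normal_form by (auto simp: NF_def nf_eq)
next
  fix n assume "n \<in> {n. rnormal n \<and> (\<exists>N. vsteps M N \<and> n \<in> taylor N)}"
  then obtain N where "rnormal n" "vsteps M N" "n \<in> taylor N" by blast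
  with taylor_vsteps_normal_form_back[OF this(2,3) rtranclp.rtrancl_refl] show "n \<in> NF (taylor M)"
    by (auto simp: NF_def nf_eq)
qed

section \<open>Approximants\<close>

text \<open>Among the normal terms, these are the ones coming from approximants of the shape \<open>C\<close>.\<close>

definition lam_headed :: "rsimp \<Rightarrow> bool" where
  "lam_headed t \<longleftrightarrow> (\<exists>u s. t = RA (RB {#RL u#}) s)"

lemma lam_headed_simps [simp]:
  "\<not> lam_headed (RB b)"
  "lam_headed (RA (RB {#v#}) t) \<longleftrightarrow> (\<exists>u. v = RL u)"
  "\<not> lam_headed (RA (RA r s) t)"
  by (auto simp: lam_headed_def)

lemma rnormal_RB: "rnormal (RB b) \<longleftrightarrow> (\<forall>t. RL t \<in># b \<longrightarrow> rnormal t)"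
proof
  assume *: "rnormal (RB b)"
  show "\<forall>t. RL t \<in># b \<longrightarrow> rnormal t"
  proof (intro allI impI)
    fix t assume "RL t \<in># b"
    then obtain c where "b = add_mset (RL t) c" by (meson mset_add)
    then show "rnormal t" using * r_bag_RL unfolding rnormal_def by blast
  qed
qed (auto simp: rnormal_def elim!: rstep_s_RB_cases)

text \<open>Besides normality of the components, the conjuncts say that none of sigma1, zero, sigma3
  and beta applies at the root.\<close>

lemma rnormal_RA:
  "rnormal (RA s t) \<longleftrightarrow> rnormal s \<and> rnormal t \<and> \<not> lam_headed s \<and>
    (\<forall>b. s = RB b \<longrightarrow> (\<exists>v. b = {#v#} \<and> \<not> lam_headed t \<and> (\<forall>u c. v = RL u \<longrightarrow> t \<noteq> RB c)))"
  (is "?L \<longleftrightarrow> ?R")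
proof
  assume L: ?L
  have "rnormal s" using L r_appl unfolding rnormal_def by blast
  moreover have "rnormal t" using L r_appr unfolding rnormal_def by blast
  moreover have "\<not> lam_headed s" using L r_sigma1 unfolding rnormal_def lam_headed_def by blast
  moreover have "\<exists>v. b = {#v#} \<and> \<not> lam_headed t \<and> (\<forall>u c. v = RL u \<longrightarrow> t \<noteq> RB c)" if s: "s = RB b" for b
  proof -
    have "size b = 1" using L r_zero s unfolding rnormal_def by blast
    then obtain v where v: "b = {#v#}" using size_1_singleton_mset by blast
    have "\<not> lam_headed t" using L r_sigma3 s v unfolding rnormal_def lam_headed_def by blast
    moreover have "t \<noteq> RB c" if "v = RL u" for u c using L r_beta s v that unfolding rnormal_def by blast
    ultimately show ?thesis using v by blast
  qed
  ultimately show ?R by blast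
next
  assume R: ?R
  show ?L unfolding rnormal_def
  proof
    assume "\<exists>T. rstep_s (RA s t) T"
    then obtain T where "rstep_s (RA s t) T" by blast
    then show False
      by cases (use R in \<open>auto simp: rnormal_def lam_headed_def\<close>)
  qed
qed

section \<open>Normality of the expansions of approximants\<close>

lemma bapps_Nil [simp]: "bapps h [] = h"
  by (simp add: bapps_def)

lemma bapps_snoc [simp]: "bapps h (As @ [A]) = BApp (bapps h As) A"
  by (simp add: bapps_def)

lemma Tn_head_bapps: "Tn_head (bapps (BApp h B) As) = Tn (bapps (BApp h B) As)"
  by (induction As rule: rev_induct) auto

text \<open>Explains the asymmetry in the grammar: the first argument meets the singleton bag of the
  head variable, where a lambda-headed term would give a sigma3 redex. Later arguments stand to the
  right of an application, so any approximant is allowed there.\<close>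

lemma Tn_bapps_normal:
  assumes "\<forall>t\<in>Tn B. rnormal t \<and> \<not> lam_headed t" "\<forall>a\<in>set As. \<forall>t\<in>Tn a. rnormal t"
    "t \<in> Tn (bapps (BApp (BVar x) B) As)"
  shows "rnormal t \<and> \<not> lam_headed t \<and> (\<exists>r s. t = RA r s)"
  using assms(2,3)
proof (induction As arbitrary: t rule: rev_induct)
  case Nil
  then show ?case using assms(1) by (auto simp: rnormal_RA rnormal_RB)
next
  case (snoc A As)
  then obtain r s where "t = RA r s" "r \<in> Tn (bapps (BApp (BVar x) B) As)" "s \<in> Tn A"
    by (auto simp: Tn_head_bapps)
  moreover from this snoc have "rnormal r \<and> \<not> lam_headed r \<and> (\<exists>r' s'. r = RA r' s')" by auto
  ultimately show ?case using snoc.prems(1) by (auto simp: rnormal_RA)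
qed

text \<open>In the shape \<open>C\<close> the argument of the abstraction is an application with a
  variable at its head. It is not a bag, which excludes beta, and not lambda-headed, which excludes
  sigma3.\<close>

lemma Tn_normal:
  "isA A \<Longrightarrow> \<forall>t\<in>Tn A. rnormal t"
  "isB B \<Longrightarrow> \<forall>t\<in>Tn B. rnormal t \<and> \<not> lam_headed t"
proof (induction rule: isA_isB.inducts)
  case (B_app B As x)
  then show ?case using Tn_bapps_normal[of B As] by blast
next
  case (A_C A B As y)
  show ?case
  proof
    fix t assume "t \<in> Tn (BApp (BLam A) (bapps (BApp (BVar y) B) As))"
    then obtain u s where t: "t = RA (RB {#RL u#}) s" "u \<in> Tn A" "s \<in> Tn (bapps (BApp (BVar y) B) As)"
      by auto
    moreover have "rnormal s \<and> \<not> lam_headed s \<and> (\<exists>r s'. s = RA r s')"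
      using Tn_bapps_normal[OF _ _ t(3)] A_C by blast
    ultimately show "rnormal t" using A_C.IH(1) by (auto simp: rnormal_RA rnormal_RB)
  qed
qed (auto simp: rnormal_RB)

text \<open>Transitivity of \<open>bleq\<close> passes through terms that contain
  \<open>Bot\<close>, so monotonicity can be proved by induction only for an expansion defined on
  all of them. The empty bag is the element common to the expansions of all values.\<close>

primrec taylor_b :: "bterm \<Rightarrow> rsimp set" where
  "taylor_b (BVar x) = {RB (replicate_mset n (RV x)) | n. True}"
| "taylor_b (BLam A) = {RB (mset (map RL ts)) | ts. \<forall>t\<in>set ts. t \<in> taylor_b A}"
| "taylor_b (BApp A B) = {RA s t | s t. s \<in> taylor_b A \<and> t \<in> taylor_b B}"
| "taylor_b Bot = {RB {#}}"

lemma taylor_b_emb: "taylor_b (emb M) = taylor M"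
  by (induction M) auto

lemma taylor_b_mono: "bleq A B \<Longrightarrow> taylor_b A \<subseteq> taylor_b B"
proof (induction rule: bleq.induct)
  case (bleq_bot_var x)
  have "{#} = replicate_mset 0 (RV x)" by simp
  then show ?case unfolding taylor_b.simps by blast
next
  case (bleq_bot_lam M)
  have "{#} = mset (map RL [])" by simp
  then show ?case unfolding taylor_b.simps by fastforce
next
  case (bleq_lam M M')
  then show ?case unfolding taylor_b.simps by blast
qed auto

text \<open>The normalized expansion only restricts the bags in head position to singletons, which
  the full expansion also contains.\<close>

lemma Tn_subset_taylor_b: "Tn A \<subseteq> taylor_b A" "Tn_head A \<subseteq> taylor_b A"
proof (induction A)
  case (BVar x)
  {
    case 2
    have "{#RV x#} = replicate_mset 1 (RV x)" by simp
    then show ?case unfolding taylor_b.simps Tn_head.simps by blast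
  }
next
  case (BLam A)
  {
    case 1
    then show ?case using BLam by auto
  next
    case 2
    have "RB (mset (map RL [s])) \<in> taylor_b (BLam A)" if "s \<in> Tn A" for s
      using BLam(1) that unfolding taylor_b.simps by (intro CollectI exI[of _ "[s]"]) auto
    then show ?case by auto
  }
qed (auto; blast)+

lemma Tn_subset_taylor: "bleq A (emb N) \<Longrightarrow> Tn A \<subseteq> taylor N"
  using Tn_subset_taylor_b(1) taylor_b_mono taylor_b_emb by blast

text \<open>The applications with a variable at the head, which the grammar uses both as a form of
  \<open>B\<close> and as the argument in \<open>C\<close>.\<close>

definition isH :: "bterm \<Rightarrow> bool" where
  "isH A \<longleftrightarrow> (\<exists>x B As. isB B \<and> (\<forall>a\<in>set As. isA a) \<and> A = bapps (BApp (BVar x) B) As)"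

lemma isH_isB: "isH A \<Longrightarrow> isB A"
  by (auto simp: isH_def intro: B_app)

lemma isH_Tn_head: "isH A \<Longrightarrow> Tn_head A = Tn A"
  by (auto simp: isH_def Tn_head_bapps)

lemma isH_BVar: "isB B \<Longrightarrow> isH (BApp (BVar x) B)"
  unfolding isH_def by (intro exI[of _ x] exI[of _ B] exI[of _ "[]"]) simp

lemma isH_BApp:
  assumes "isH H" "isA A"
  shows "isH (BApp H A)"
proof -
  obtain x B As where "isB B" "\<forall>a\<in>set As. isA a" "H = bapps (BApp (BVar x) B) As"
    using assms(1) isH_def by auto
  then show ?thesis unfolding isH_def using assms(2)
    by (intro exI[of _ x] exI[of _ B] exI[of _ "As @ [A]"]) auto
qed

lemma isA_BLam_BApp: "isA A \<Longrightarrow> isH H \<Longrightarrow> isA (BApp (BLam A) H)"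
  by (auto simp: isH_def intro: A_C)

lemma bleq_BApp: "bleq A A' \<Longrightarrow> bleq B B' \<Longrightarrow> bleq (BApp A B) (BApp A' B')"
  by (meson bleq_appl bleq_appr bleq_trans)

text \<open>Finite sets are needed because the elements of a bag must be covered by one approximant.\<close>

lemma approximant_of_normal_set:
  assumes "finite S" "S \<noteq> {}" "S \<subseteq> taylor N" "\<forall>t\<in>S. rnormal t"
  shows "\<exists>A. isA A \<and> bleq A (emb N) \<and> S \<subseteq> Tn A \<and>
    ((\<forall>t\<in>S. \<not> lam_headed t) \<longrightarrow> isB A \<and> ((\<forall>t\<in>S. \<exists>r s. t = RA r s) \<longrightarrow> isH A))"
  using assms
proof (induction N arbitrary: S rule: measure_induct_rule[of size])
  case (less N)
  show ?case
  proof (cases N)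
    case (Var x)
    then have "S \<subseteq> Tn (BVar x)" "\<not> (\<forall>t\<in>S. \<exists>r s. t = RA r s)" using less.prems by auto
    then show ?thesis using Var by (intro exI[of _ "BVar x"]) (auto intro: A_B B_var bleq_refl)
  next
    case (Lam M)
    have S: "\<exists>b. t = RB b \<and> set_mset b \<subseteq> RL ` taylor M" if "t \<in> S" for t
      using less.prems(3) Lam that by (meson subsetD taylor_LamE)
    then have noRA: "\<not> (\<forall>t\<in>S. \<exists>r s. t = RA r s)" using less.prems(2) by fastforce
    \<comment> \<open>All bodies that occur in any bag of \<open>S\<close>. One approximant of
      \<open>M\<close> covering \<open>U\<close> then serves every element of every bag.\<close>
    define U where "U = {t. \<exists>b. RB b \<in> S \<and> RL t \<in># b}"
    have "U \<subseteq> (\<lambda>v. case v of RL t \<Rightarrow> t) ` (\<Union>t\<in>S. case t of RB b \<Rightarrow> set_mset b | _ \<Rightarrow> {})"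
      unfolding U_def by (force intro!: image_eqI)
    moreover have "finite (\<Union>t\<in>S. case t of RB b \<Rightarrow> set_mset b | _ \<Rightarrow> {})"
      using less.prems(1) by (auto split: rsimp.split)
    ultimately have "finite U" by (meson finite_imageI finite_subset)
    have U: "U \<subseteq> taylor M" "\<forall>t\<in>U. rnormal t"
      using S less.prems(4) unfolding U_def by (fastforce simp: rnormal_RB)+
    show ?thesis
    proof (cases "U = {}")
      \<comment> \<open>Here all bags in \<open>S\<close> are empty, and \<open>Bot\<close> has
        exactly this expansion. The induction hypothesis excludes empty sets, since for them the
        conditions on \<open>S\<close> would hold vacuously and demand \<open>isH A\<close> even for
        a variable.\<close>
      case True
      have "t = RB {#}" if t: "t \<in> S" for t
      proof -
        obtain b where b: "t = RB b" "set_mset b \<subseteq> RL ` taylor M" using S t by blast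
        then have "set_mset b = {}" using True t unfolding U_def by blast
        then show ?thesis using b by simp
      qed
      then have "S \<subseteq> Tn Bot" by auto
      then show ?thesis using noRA Lam by (intro exI[of _ Bot]) (auto intro: A_B B_bot bleq_bot_lam)
    next
      case False
      with less.IH[of M U] \<open>finite U\<close> U Lam obtain A where A: "isA A" "bleq A (emb M)" "U \<subseteq> Tn A" by auto
      have "S \<subseteq> Tn (BLam A)"
      proof
        fix t assume t: "t \<in> S"
        then obtain b where b: "t = RB b" "set_mset b \<subseteq> RL ` taylor M" using S by blast
        then have "set_mset b \<subseteq> RL ` Tn A" using A(3) t unfolding U_def by blast
        then obtain c where "b = image_mset RL c" "set_mset c \<subseteq> Tn A" by (auto simp: set_mset_subset_image)
        moreover obtain ts where "c = mset ts" by (metis ex_mset)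
        ultimately show "t \<in> Tn (BLam A)" using b(1) by auto
      qed
      then show ?thesis using A noRA Lam
        by (intro exI[of _ "BLam A"]) (auto intro: A_B B_lam bleq_lam)
    qed
  next
    case (App P Q)
    have S: "\<exists>r s. t = RA r s \<and> r \<in> taylor P \<and> s \<in> taylor Q" if "t \<in> S" for t
      using less.prems(3) App that by auto
    \<comment> \<open>The expansion of an application is a full product, so it suffices to cover the
      two projections of \<open>S\<close> separately.\<close>
    define S1 where "S1 = {r. \<exists>s. RA r s \<in> S}"
    define S2 where "S2 = {s. \<exists>r. RA r s \<in> S}"
    have "S1 \<subseteq> (\<lambda>t. case t of RA r s \<Rightarrow> r) ` S" "S2 \<subseteq> (\<lambda>t. case t of RA r s \<Rightarrow> s) ` S"
      unfolding S1_def S2_def by (force intro!: image_eqI)+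
    then have fin: "finite S1" "finite S2" using less.prems(1) by (meson finite_imageI finite_subset)+
    have ne: "S1 \<noteq> {}" "S2 \<noteq> {}" using S less.prems(2) unfolding S1_def S2_def by blast+
    have sub: "S1 \<subseteq> taylor P" "S2 \<subseteq> taylor Q" using S unfolding S1_def S2_def by blast+
    have norm: "\<forall>t\<in>S1. rnormal t" "\<forall>t\<in>S2. rnormal t"
      using less.prems(4) unfolding S1_def S2_def by (auto simp: rnormal_RA)
    have "size P < size N" "size Q < size N" using App by auto
    note IH = less.IH[OF this(1) fin(1) ne(1) sub(1) norm(1)] less.IH[OF this(2) fin(2) ne(2) sub(2) norm(2)]
    show ?thesis
    proof (cases P)
      case (Var x)
      have *: "r = RB {#RV x#} \<and> \<not> lam_headed s" if rs: "RA r s \<in> S" for r s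
      proof -
        obtain n where n: "r = RB (replicate_mset n (RV x))" using S[OF rs] Var by auto
        moreover have "rnormal (RA r s)" using less.prems(4) rs by blast
        ultimately obtain v where v: "replicate_mset n (RV x) = {#v#}" "\<not> lam_headed s"
          by (auto simp: rnormal_RA)
        then have "v \<in># replicate_mset n (RV x)" by simp
        then have "v = RV x" by (simp only: in_replicate_mset)
        then show ?thesis using n v by simp
      qed
      then obtain B where B: "isB B" "bleq B (emb Q)" "S2 \<subseteq> Tn B" using IH(2) unfolding S2_def by blast
      have "S \<subseteq> Tn (BApp (BVar x) B)"
      proof
        fix t assume t: "t \<in> S"
        then obtain r s where "t = RA r s" using S by blast
        then show "t \<in> Tn (BApp (BVar x) B)" using * t B(3) unfolding S2_def by auto
      qed
      moreover have "bleq (BApp (BVar x) B) (emb N)" using App Var B by (auto intro: bleq_appr)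
      ultimately show ?thesis using B(1) isH_BVar isH_isB A_B by blast
    next
      case (Lam P0)
      \<comment> \<open>The induction hypothesis is applied to the body \<open>P0\<close> instead of
        \<open>P\<close>, so that the approximant of \<open>P\<close> is visibly an abstraction, as
        the shape \<open>C\<close> requires. Normality forces all bags in \<open>S1\<close> to be
        singletons.\<close>
      define U where "U = {u. RB {#RL u#} \<in> S1}"
      have *: "\<exists>u. r = RB {#RL u#} \<and> u \<in> taylor P0 \<and> \<not> lam_headed s \<and> (\<exists>r' s'. s = RA r' s')"
        if rs: "RA r s \<in> S" for r s
      proof -
        obtain b where b: "r = RB b" "set_mset b \<subseteq> RL ` taylor P0"
          using S[OF rs] Lam by (metis rsimp.inject(1) taylor_LamE)
        have "rnormal (RA r s)" using less.prems(4) rs by blast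
        then obtain v where v: "b = {#v#}" "\<not> lam_headed s" "\<forall>u c. v = RL u \<longrightarrow> s \<noteq> RB c"
          using b(1) by (auto simp: rnormal_RA)
        then show ?thesis using b by (cases s) auto
      qed
      have "finite U" unfolding U_def
        using finite_vimageI[OF fin(1), of "\<lambda>u. RB {#RL u#}"] by (simp add: inj_def vimage_def)
      moreover have "U \<noteq> {}" using * ne(1) unfolding U_def S1_def by blast
      moreover have "U \<subseteq> taylor P0" using * unfolding U_def S1_def by fastforce
      moreover have "\<forall>u\<in>U. rnormal u" using norm(1) unfolding U_def by (auto simp: rnormal_RB)
      moreover have "size P0 < size N" using App Lam by simp
      ultimately obtain A where A: "isA A" "bleq A (emb P0)" "U \<subseteq> Tn A" using less.IH[of P0 U] by auto
      have "\<forall>t\<in>S2. \<not> lam_headed t \<and> (\<exists>r s. t = RA r s)" using * unfolding S2_def by blast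
      with IH(2) obtain H where H: "isH H" "bleq H (emb Q)" "S2 \<subseteq> Tn H" by metis
      have "S \<subseteq> Tn (BApp (BLam A) H)"
      proof
        fix t assume t: "t \<in> S"
        then obtain r s where rs: "t = RA r s" using S by blast
        with * t obtain u where u: "r = RB {#RL u#}" by blast
        then have "u \<in> Tn A" "s \<in> Tn H" using t rs A(3) H(3) unfolding U_def S1_def S2_def by blast+
        then show "t \<in> Tn (BApp (BLam A) H)" using rs u by auto
      qed
      moreover have "bleq (BApp (BLam A) H) (emb N)" using App Lam A H by (auto intro: bleq_BApp bleq_lam)
      moreover have "isA (BApp (BLam A) H)" using A H isA_BLam_BApp by blast
      moreover have "\<not> (\<forall>t\<in>S. \<not> lam_headed t)"
      proof -
        obtain t where t: "t \<in> S" using less.prems(2) by blast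
        then obtain r s where "t = RA r s" using S by blast
        then have "lam_headed t" using *[of r s] t unfolding lam_headed_def by blast
        then show ?thesis using t by blast
      qed
      ultimately show ?thesis by blast
    next
      case (App P1 P2)
      have *: "\<not> lam_headed r \<and> (\<exists>r' s'. r = RA r' s')" if "RA r s \<in> S" for r s
      proof -
        have "rnormal (RA r s)" using less.prems(4) that by blast
        moreover have "\<exists>r' s'. r = RA r' s'" using S[OF that] App by auto
        ultimately show ?thesis by (auto simp: rnormal_RA)
      qed
      have "\<forall>t\<in>S1. \<not> lam_headed t \<and> (\<exists>r s. t = RA r s)" using * unfolding S1_def by blast
      with IH(1) obtain H where H: "isH H" "bleq H (emb P)" "S1 \<subseteq> Tn H" by metis
      obtain A where A: "isA A" "bleq A (emb Q)" "S2 \<subseteq> Tn A" using IH(2) by metis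
      have "S \<subseteq> Tn (BApp H A)"
      proof
        fix t assume t: "t \<in> S"
        then obtain r s where rs: "t = RA r s" using S by blast
        then have "r \<in> Tn H" "s \<in> Tn A" using t A(3) H(3) unfolding S1_def S2_def by blast+
        then show "t \<in> Tn (BApp H A)" using rs isH_Tn_head[OF H(1)] by auto
      qed
      moreover have "bleq (BApp H A) (emb N)" using \<open>N = App P Q\<close> A H by (auto intro: bleq_BApp)
      moreover have "isH (BApp H A)" using A H isH_BApp by blast
      ultimately show ?thesis using isH_isB A_B by blast
    qed
  qed
qed

theorem theorem4p11:
  fixes M :: lterm
  shows "(\<Union>A\<in>approxs M. Tn A) = NF (taylor M)"
proof (intro set_eqI iffI)
  fix n assume "n \<in> (\<Union>A\<in>approxs M. Tn A)"
  then obtain A N where "isA A" "vsteps M N" "bleq A (emb N)" "n \<in> Tn A" by (auto simp: approxs_def)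
  then show "n \<in> NF (taylor M)" unfolding NF_taylor using Tn_normal(1) Tn_subset_taylor by blast
next
  fix n assume "n \<in> NF (taylor M)"
  then obtain N where N: "rnormal n" "vsteps M N" "n \<in> taylor N" unfolding NF_taylor by blast
  \<comment> \<open>A singleton is enough here; larger sets arise only inside the induction, from
    bags with several elements.\<close>
  then obtain A where "isA A" "bleq A (emb N)" "n \<in> Tn A"
    using approximant_of_normal_set[of "{n}" N] by auto
  then show "n \<in> (\<Union>A\<in>approxs M. Tn A)" using N(2) by (auto simp: approxs_def)
qed

end
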